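(* Precisely one of the following assertions is true: 1. for each $f\in L^2_V(\mathbb{T})$ there exists a unique weak solution $u\in H_{W,V}(\mathbb{T})$ of $L_{W,V}u=f$; or else 2. there is a weak solution $u\not\equiv0$, $u\in H_{W,V}(\mathbb{T})$, of the homogeneous problem $L_{W,V}u=0$. Moreover, if 2. is true, then $\dim\ker L_{W,V}<\infty$, and, for $f\in L^2_V(\mathbb{T})$, the equation $L_{W,V}u=f$ has a weak solution if and only if $\int_{\mathbb{T}}vf\,dV=0$ for every $v\in\ker L_{W,V}$.
   Context: Notation. $\mathbb{T}=\mathbb{R}/\mathbb{Z}$, identified with $[0,1)$; functions on $\mathbb{T}$ are identified with $1$-periodic functions on $\mathbb{R}$. Càdlàg means right-continuous with left limits; càglàd means left-continuous with right limits. $W,V:\mathbb{R}\to\mathbb{R}$ are strictly increasing, $W$ is càdlàg, $V$ is càglàd, and $W(x+1)-W(x)=W(1)-W(0)$, $V(x+1)-V(x)=V(1)-V(0)$ for all $x\in\mathbb{R}$; both are continuous at $0$ and $W(0)=V(0)=0$. No further continuity is assumed. $dW$ and $dV$ are the induced finite Borel measures on $\mathbb{T}$, with $dW((a,b])=W(b)-W(a)$ and $dV([a,b))=V(b)-V(a)$. $L^2_W(\mathbb{T})$, $L^2_V(\mathbb{T})$ are the corresponding (real) $L^2$ spaces with inner products $(\cdot,\cdot)_W=\langle\cdot,\cdot\rangle_W$, $(\cdot,\cdot)_V=\langle\cdot,\cdot\rangle_V$; $L^2_{W,0}(\mathbb{T})=\{F\in L^2_W(\mathbb{T}):\int_{\mathbb{T}}F\,dW=0\}$.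 Lateral derivatives: $D^-_Wf(x)=\lim_{h\to0^-}\frac{f(x+h)-f(x)}{W(x+h)-W(x)}$ and $D^+_Vg(x)=\lim_{h\to0^+}\frac{g(x+h)-g(x)}{V(x+h)-V(x)}$. $\mathfrak{D}_{W,V}(\mathbb{T})$ is the set of càdlàg $f:\mathbb{T}\to\mathbb{R}$ such that $D^-_Wf$ exists everywhere and is càglàd, and $D^+_VD^-_Wf$ exists everywhere and is càdlàg. $H_{W,V}(\mathbb{T})$ is the set of $f\in L^2_V(\mathbb{T})$ that are $L^2_V$-limits of sequences in $\mathfrak{D}_{W,V}(\mathbb{T})$ that are Cauchy for the energetic norm $\|f\|_{1,2}^2=\langle(I-D^+_VD^-_W)f,f\rangle_V$. Equivalently, $f\in H_{W,V}(\mathbb{T})$ iff $f(x)=c+\int_{(0,x]}F\,dW$ $V$-a.e. for some $c\in\mathbb{R}$ and some (unique) $F\in L^2_{W,0}(\mathbb{T})$, and one writes $D^-_Wf:=F$. Coefficients: $A:\mathbb{T}\to\mathbb{R}$ is Borel measurable with $0<A_0\le A(x)\le K$ for all $x$ and some constants $A_0,K$; $\kappa:\mathbb{T}\to\mathbb{R}$ is Borel measurable and bounded. The formal operator is $L_{W,V}u=-D^+_VAD^-_Wu+\kappa^2u$, with bilinear form on $H_{W,V}(\mathbb{T})$ $$B_{W,V}[u,v]=\int_{\mathbb{T}}A\,D^-_Wu\,D^-_Wv\,dW+\int_{\mathbb{T}}\kappa^2uv\,dV.$$ For $f\in L^2_V(\mathbb{T})$, $u\in H_{W,V}(\mathbb{T})$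 is a weak solution of $L_{W,V}u=f$ if $B_{W,V}[u,v]=(f,v)_V$ for all $v\in H_{W,V}(\mathbb{T})$. $\ker L_{W,V}=\{w\in H_{W,V}(\mathbb{T}):B_{W,V}[w,v]=0\ \forall v\in H_{W,V}(\mathbb{T})\}$. *)

theory Defs
  imports "HOL-Analysis.Analysis"
begin

text \<open>
  The torus is \<open>[0,1)\<close> with its endpoints identified; functions on it are the functions
  \<open>real \<Rightarrow> real\<close> of period 1.
\<close>

definition one_periodic :: "(real \<Rightarrow> real) \<Rightarrow> bool" where
  "one_periodic f \<longleftrightarrow> (\<forall>x. f (x + 1) = f x)"

definition cadlag :: "(real \<Rightarrow> real) \<Rightarrow> bool" where
  "cadlag f \<longleftrightarrow> (\<forall>x. continuous (at_right x) f \<and> (\<exists>l. (f \<longlongrightarrow> l) (at_left x)))"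

definition caglad :: "(real \<Rightarrow> real) \<Rightarrow> bool" where
  "caglad f \<longleftrightarrow> (\<forall>x. continuous (at_left x) f \<and> (\<exists>l. (f \<longlongrightarrow> l) (at_right x)))"

definition dW :: "(real \<Rightarrow> real) \<Rightarrow> real measure" where
  "dW W = restrict_space (interval_measure W) {0..<1}"

text \<open>
  \<^const>\<open>interval_measure\<close> gives \<open>{a<..b}\<close> the mass \<open>F b - F a\<close> and needs \<open>F\<close> right-continuous.
  For the left-continuous \<open>V\<close> it is applied to the reflection \<open>x \<mapsto> - V (- x)\<close>, and the result is
  reflected back; \<open>emeasure_dV_Ico\<close> below is the characterising property.
\<close>

definition dV :: "(real \<Rightarrow> real) \<Rightarrow> real measure" where
  "dV V = restrict_space (distr (interval_measure (\<lambda>x. - V (- x))) borel uminus) {0..<1}"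

lemma emeasure_dW_Ioc:
  assumes "strict_mono W" "cadlag W" "0 \<le> a" "a \<le> b" "b < 1"
  shows "emeasure (dW W) {a<..b} = ennreal (W b - W a)"
proof -
  have "emeasure (dW W) {a<..b} = emeasure (interval_measure W) {a<..b}"
    unfolding dW_def by (rule emeasure_restrict_space) (use assms in auto)
  also have "\<dots> = ennreal (W b - W a)"
    using assms by (intro emeasure_interval_measure_Ioc) (auto simp: strict_mono_less_eq cadlag_def)
  finally show ?thesis .
qed

lemma emeasure_dV_Ico:
  assumes "strict_mono V" "caglad V" "0 \<le> a" "a \<le> b" "b \<le> 1"
  shows "emeasure (dV V) {a..<b} = ennreal (V b - V a)"
proof -
  have rc: "continuous (at_right x) (\<lambda>x. - V (- x))" for x
  proof -
    have "(V \<longlongrightarrow> V (- x)) (at_left (- x))"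
      using assms(2) by (auto simp: caglad_def continuous_within)
    then have "((\<lambda>y. V (- y)) \<longlongrightarrow> V (- x)) (at_right x)"
      by (simp add: at_left_minus filterlim_filtermap)
    then show ?thesis
      by (auto simp: continuous_within intro: tendsto_minus)
  qed
  have "emeasure (dV V) {a..<b}
      = emeasure (distr (interval_measure (\<lambda>x. - V (- x))) borel uminus) {a..<b}"
    unfolding dV_def by (rule emeasure_restrict_space) (use assms in auto)
  also have "\<dots> = emeasure (interval_measure (\<lambda>x. - V (- x))) {- b<..- a}"
    by (subst emeasure_distr) (auto intro!: arg_cong[where f = "emeasure _"])
  also have "\<dots> = ennreal (- V (- (- a)) - - V (- (- b)))"
    using assms(1,4) by (intro emeasure_interval_measure_Ioc rc) (auto simp: strict_mono_less_eq)
  finally show ?thesis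
    by simp
qed

text \<open>
  Elements of \<open>L\<^sup>2\<close> are represented by functions, not by classes modulo null sets; equality of
  elements is therefore always written as equality almost everywhere.
\<close>

definition torus_L2 :: "real measure \<Rightarrow> (real \<Rightarrow> real) set" where
  "torus_L2 M = {f. one_periodic f \<and> f \<in> borel_measurable M \<and> integrable M (\<lambda>x. (f x)\<^sup>2)}"

definition torus_L2_0 :: "real measure \<Rightarrow> (real \<Rightarrow> real) set" where
  "torus_L2_0 M = {F \<in> torus_L2 M. (LINT x|M. F x) = 0}"

definition L2_inner :: "real measure \<Rightarrow> (real \<Rightarrow> real) \<Rightarrow> (real \<Rightarrow> real) \<Rightarrow> real" where
  "L2_inner M f g = (LINT x|M. f x * g x)"

definition L2_norm :: "real measure \<Rightarrow> (real \<Rightarrow> real) \<Rightarrow> real" where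
  "L2_norm M f = sqrt (L2_inner M f f)"

definition has_left_DW :: "(real \<Rightarrow> real) \<Rightarrow> (real \<Rightarrow> real) \<Rightarrow> real \<Rightarrow> real \<Rightarrow> bool" where
  "has_left_DW W f x l \<longleftrightarrow> ((\<lambda>h. (f (x + h) - f x) / (W (x + h) - W x)) \<longlongrightarrow> l) (at_left 0)"

definition has_right_DV :: "(real \<Rightarrow> real) \<Rightarrow> (real \<Rightarrow> real) \<Rightarrow> real \<Rightarrow> real \<Rightarrow> bool" where
  "has_right_DV V g x l \<longleftrightarrow> ((\<lambda>h. (g (x + h) - g x) / (V (x + h) - V x)) \<longlongrightarrow> l) (at_right 0)"

definition DW :: "(real \<Rightarrow> real) \<Rightarrow> (real \<Rightarrow> real) \<Rightarrow> real \<Rightarrow> real" where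
  "DW W f x = (THE l. has_left_DW W f x l)"

definition DV :: "(real \<Rightarrow> real) \<Rightarrow> (real \<Rightarrow> real) \<Rightarrow> real \<Rightarrow> real" where
  "DV V g x = (THE l. has_right_DV V g x l)"

definition frakD :: "(real \<Rightarrow> real) \<Rightarrow> (real \<Rightarrow> real) \<Rightarrow> (real \<Rightarrow> real) set" where
  "frakD W V = {f. one_periodic f \<and> cadlag f
     \<and> (\<forall>x. \<exists>l. has_left_DW W f x l) \<and> caglad (DW W f)
     \<and> (\<forall>x. \<exists>l. has_right_DV V (DW W f) x l) \<and> cadlag (DV V (DW W f))}"

definition energy_norm :: "(real \<Rightarrow> real) \<Rightarrow> (real \<Rightarrow> real) \<Rightarrow> (real \<Rightarrow> real) \<Rightarrow> real" where
  "energy_norm W V f = sqrt (L2_inner (dV V) (\<lambda>x. f x - DV V (DW W f) x) f)"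

definition H_space :: "(real \<Rightarrow> real) \<Rightarrow> (real \<Rightarrow> real) \<Rightarrow> (real \<Rightarrow> real) set" where
  "H_space W V = {f \<in> torus_L2 (dV V). \<exists>\<phi>::nat \<Rightarrow> real \<Rightarrow> real.
     (\<forall>n. \<phi> n \<in> frakD W V)
     \<and> (\<forall>e>0. \<exists>N. \<forall>m\<ge>N. \<forall>n\<ge>N. energy_norm W V (\<lambda>x. \<phi> m x - \<phi> n x) < e)
     \<and> (\<lambda>n. L2_norm (dV V) (\<lambda>x. \<phi> n x - f x)) \<longlonglongrightarrow> 0}"

text \<open>
  The weak derivative of an element of \<^const>\<open>H_space\<close> is determined only \<open>dW\<close>-almost everywhere;
  the choice operator picks a representative.
\<close>

definition is_weak_DW :: "(real \<Rightarrow> real) \<Rightarrow> (real \<Rightarrow> real) \<Rightarrow> (real \<Rightarrow> real) \<Rightarrow> (real \<Rightarrow> real) \<Rightarrow> bool"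
  where
  "is_weak_DW W V f F \<longleftrightarrow> F \<in> torus_L2_0 (dW W)
     \<and> (\<exists>c. AE x in dV V. f x = c + (LINT y:{0<..x}|dW W. F y))"

definition weak_DW :: "(real \<Rightarrow> real) \<Rightarrow> (real \<Rightarrow> real) \<Rightarrow> (real \<Rightarrow> real) \<Rightarrow> real \<Rightarrow> real" where
  "weak_DW W V f = (SOME F. is_weak_DW W V f F)"

definition B_form ::
  "(real \<Rightarrow> real) \<Rightarrow> (real \<Rightarrow> real) \<Rightarrow> (real \<Rightarrow> real) \<Rightarrow> (real \<Rightarrow> real) \<Rightarrow>
   (real \<Rightarrow> real) \<Rightarrow> (real \<Rightarrow> real) \<Rightarrow> real" where
  "B_form W V A \<kappa> u v =
     (LINT x|dW W. A x * weak_DW W V u x * weak_DW W V v x)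
     + (LINT x|dV V. (\<kappa> x)\<^sup>2 * u x * v x)"

definition weak_solution ::
  "(real \<Rightarrow> real) \<Rightarrow> (real \<Rightarrow> real) \<Rightarrow> (real \<Rightarrow> real) \<Rightarrow> (real \<Rightarrow> real) \<Rightarrow>
   (real \<Rightarrow> real) \<Rightarrow> (real \<Rightarrow> real) \<Rightarrow> bool" where
  "weak_solution W V A \<kappa> f u \<longleftrightarrow>
     u \<in> H_space W V \<and> (\<forall>v\<in>H_space W V. B_form W V A \<kappa> u v = L2_inner (dV V) f v)"

definition ker_L ::
  "(real \<Rightarrow> real) \<Rightarrow> (real \<Rightarrow> real) \<Rightarrow> (real \<Rightarrow> real) \<Rightarrow> (real \<Rightarrow> real) \<Rightarrow> (real \<Rightarrow> real) set" where
  "ker_L W V A \<kappa> = {w \<in> H_space W V. \<forall>v\<in>H_space W V. B_form W V A \<kappa> w v = 0}"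

text \<open>
  Finite dimension of the space of classes modulo \<open>M\<close>-null sets represented by \<open>S\<close>: some
  finite subset spans it up to almost-everywhere equality.
\<close>

definition finite_dim_ae :: "real measure \<Rightarrow> (real \<Rightarrow> real) set \<Rightarrow> bool" where
  "finite_dim_ae M S \<longleftrightarrow> (\<exists>B. finite B \<and> B \<subseteq> S \<and>
     (\<forall>w\<in>S. \<exists>a. AE x in M. w x = (\<Sum>b\<in>B. a b * b x)))"

end

theory Submission
  imports Defs
begin

text \<open>
  Since \<open>\<kappa>\<close> enters the form \<open>B\<close> only through its square and \<open>A \<ge> A0 > 0\<close>, the form is symmetric and positive
  semidefinite, and the alternative is decided by \<open>\<kappa>\<close> alone. If \<open>B[w,w] = 0\<close>, then the weak derivative
  of \<open>w\<close> vanishes \<open>dW\<close>-a.e., so \<open>w\<close> is a constant \<open>d\<close> with \<open>\<kappa> d = 0\<close> \<open>dV\<close>-a.e.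
  (\<open>form_self_zero\<close>). Hence two solutions for the same \<open>f\<close> differ by such a constant, and there is a
  nontrivial kernel exactly when \<open>\<kappa> = 0\<close> \<open>dV\<close>-a.e., in which case the kernel consists of the functions
  that are \<open>dV\<close>-a.e. constant. What remains is existence: for every \<open>f\<close> if \<open>\<kappa>\<close> is not a.e. zero, and for every
  \<open>f\<close> of mean zero if it is.

  Existence is variational. On the classical functions \<open>frakD\<close> one minimises
  \<open>J \<phi> = B[\<phi>,\<phi>] - 2 (f,\<phi>)\<close> (\<open>minimizing_sequence_represents\<close>); where \<open>B\<close> controls the \<open>L\<^sup>2\<close> norm a
  minimising sequence is Cauchy for the energy norm, so it has a limit in \<open>H_space\<close>, and the limit solves
  the equation (\<open>coercive_solution\<close>). The squared deviation of a classical function \<open>\<phi>\<close> from its value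
  at \<open>0\<close> is at most a multiple of \<open>B[\<phi>,\<phi>]\<close>. When \<open>\<kappa>\<close> is not a.e. zero this gives coercivity on all of
  \<open>frakD\<close>, because \<open>\<integral>\<kappa>\<^sup>2\<phi>\<^sup>2 dV\<close> and the deviation together control the value at \<open>0\<close>. When \<open>\<kappa> = 0\<close> it
  gives coercivity on the functions that vanish at \<open>0\<close>; constants may be added back to the test functions
  because \<open>f\<close> is orthogonal to them.

  The link between these arguments and the definition of \<open>H_space\<close>, whose energy norm involves the
  second-order operator, is a fundamental theorem of calculus for the lateral derivatives
  (\<open>left_derivative_FTC\<close>): \<open>\<phi> x = \<phi> 0 + \<integral>\<^bsub>(0,x]\<^esub> D\<phi> dW\<close>, and the reflected statement for \<open>V\<close>. With Fubini's
  theorem it yields \<open>\<parallel>\<phi>\<parallel>\<^sub>1\<^sub>,\<^sub>2\<^sup>2 = \<integral>\<phi>\<^sup>2 dV + \<integral>(D\<phi>)\<^sup>2 dW\<close> (\<open>frakD_energy\<close>). By completeness of \<open>L\<^sup>2\<close>,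
  the derivatives of an energy-Cauchy sequence converge; their limit is a weak derivative of the limit
  function, and weak derivatives are unique a.e. because \<open>dV\<close> charges every interval
  (\<open>is_weak_DW_unique\<close>). So the representative chosen by \<open>weak_DW\<close> is that limit, and \<open>B\<close> on
  \<open>H_space\<close> is the limit of \<open>B\<close> on classical functions.
\<close>

section \<open>Minimising sequences of quadratic functionals\<close>

lemma tendsto_0_of_square_le:
  fixes a b :: "nat \<Rightarrow> real"
  assumes le: "\<And>n. (a n)\<^sup>2 \<le> b n" and b: "b \<longlonglongrightarrow> 0"
  shows "a \<longlonglongrightarrow> 0"
proof -
  have "(\<lambda>n. (a n)\<^sup>2) \<longlonglongrightarrow> 0"
    by (rule tendsto_sandwich[OF _ _ tendsto_const b]) (simp_all add: le)
  then have "(\<lambda>n. sqrt ((a n)\<^sup>2)) \<longlonglongrightarrow> sqrt 0" by (rule tendsto_real_sqrt)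
  then show ?thesis by (simp add: tendsto_rabs_zero_iff)
qed

text \<open>
  A Riesz representation theorem in which a Cauchy sequence stands for the representing element, since \<open>S\<close>
  need not be complete. For a minimising sequence of \<open>J v = q v v - 2 l v\<close>, the parallelogram identity
  bounds \<open>q\<close> of a difference by the excess of \<open>J\<close> over its infimum, and the condition that \<open>J\<close> cannot drop below the infimum in any direction \<open>v\<close>
  forces \<open>q (u n) v\<close> towards \<open>l v\<close>.
\<close>

lemma minimizing_sequence_represents:
  fixes S :: "(real \<Rightarrow> real) set" and q :: "(real \<Rightarrow> real) \<Rightarrow> (real \<Rightarrow> real) \<Rightarrow> real"
    and l :: "(real \<Rightarrow> real) \<Rightarrow> real"
  assumes ne: "S \<noteq> {}"
    and comb: "\<And>u v t. u \<in> S \<Longrightarrow> v \<in> S \<Longrightarrow> (\<lambda>x. u x + t * v x) \<in> S"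
    and q_lin: "\<And>u v w t. u \<in> S \<Longrightarrow> v \<in> S \<Longrightarrow> w \<in> S \<Longrightarrow>
      q (\<lambda>x. u x + t * v x) w = q u w + t * q v w"
    and q_sym: "\<And>u v. u \<in> S \<Longrightarrow> v \<in> S \<Longrightarrow> q u v = q v u"
    and q_pos: "\<And>u. u \<in> S \<Longrightarrow> 0 \<le> q u u"
    and l_lin: "\<And>u v t. u \<in> S \<Longrightarrow> v \<in> S \<Longrightarrow> l (\<lambda>x. u x + t * v x) = l u + t * l v"
    and C: "0 \<le> C"
    and bdd: "\<And>v. v \<in> S \<Longrightarrow> (l v)\<^sup>2 \<le> C * q v v"
  obtains u :: "nat \<Rightarrow> real \<Rightarrow> real" where "\<And>n. u n \<in> S"
    and "\<And>e. 0 < e \<Longrightarrow> \<exists>N. \<forall>m\<ge>N. \<forall>n\<ge>N. q (\<lambda>x. u m x - u n x) (\<lambda>x. u m x - u n x) < e"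
    and "\<And>v. v \<in> S \<Longrightarrow> (\<lambda>n. q (u n) v) \<longlonglongrightarrow> l v"
proof -
  define J where "J v = q v v - 2 * l v" for v
  have expand: "q (\<lambda>x. u x + t * v x) (\<lambda>x. u x + t * v x) = q u u + 2 * t * q u v + t\<^sup>2 * q v v"
    if "u \<in> S" "v \<in> S" for u v t
  proof -
    let ?w = "\<lambda>x. u x + t * v x"
    have w: "?w \<in> S" using comb that by blast
    have "q ?w ?w = q u ?w + t * q v ?w" using q_lin[OF that w] .
    also have "q u ?w = q u u + t * q v u" using q_lin[OF that that(1)] q_sym[OF that(1) w] by simp
    also have "q v ?w = q u v + t * q v v" using q_lin[OF that that(2)] q_sym[OF that(2) w] by simp
    also have "q v u = q u v" using q_sym that by blast
    finally show ?thesis by (simp add: algebra_simps power2_eq_square)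
  qed
  have J_step: "J (\<lambda>x. u x + t * v x) = J u + 2 * t * (q u v - l v) + t\<^sup>2 * q v v"
    if "u \<in> S" "v \<in> S" for u v t
    unfolding J_def expand[OF that] l_lin[OF that] by (simp add: algebra_simps)
  have J_lower: "- C \<le> J v" if "v \<in> S" for v
  proof -
    have "(2 * l v)\<^sup>2 \<le> 4 * (C * q v v)" using bdd[OF that] by (simp add: power2_eq_square)
    also have "\<dots> \<le> (C + q v v)\<^sup>2"
      using zero_le_power2[of "C - q v v"] by (simp add: power2_eq_square algebra_simps)
    finally have "\<bar>2 * l v\<bar> \<le> \<bar>C + q v v\<bar>" by (simp only: abs_le_square_iff)
    then show ?thesis using C q_pos[OF that] by (simp add: J_def)
  qed
  define d where "d = (INF v\<in>S. J v)"
  have bb: "bdd_below (J ` S)" using J_lower by (auto intro!: bdd_belowI[of _ "-C"])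
  have d_le: "d \<le> J v" if "v \<in> S" for v
    unfolding d_def using bb that by (rule cINF_lower)
  have "\<exists>v\<in>S. J v < d + inverse (real (Suc n))" for n
  proof -
    have "(INF v\<in>S. J v) < d + inverse (real (Suc n))" unfolding d_def by simp
    then show ?thesis using cINF_less_iff[OF ne bb] by blast
  qed
  then obtain u where uS: "\<And>n. u n \<in> S" and uJ: "\<And>n. J (u n) < d + inverse (real (Suc n))"
    by metis
  show ?thesis
  proof (rule that[OF uS])
    fix e :: real assume "0 < e"
    then obtain N where N: "inverse (real (Suc N)) < e / 4"
      using reals_Archimedean[of "e/4"] by auto
    have "q (\<lambda>x. u m x - u n x) (\<lambda>x. u m x - u n x) < e" if "N \<le> m" "N \<le> n" for m n
    proof -
      have D: "q (\<lambda>x. u m x - u n x) (\<lambda>x. u m x - u n x)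
          = q (u m) (u m) - 2 * q (u m) (u n) + q (u n) (u n)"
        using expand[OF uS[of m] uS[of n], of "-1"] by simp
      have "(\<lambda>x. u m x + (-1/2) * u m x) \<in> S" by (intro comb uS)
      then have mid: "(\<lambda>x. (u m x + (-1/2) * u m x) + (1/2) * u n x) \<in> S" (is "?w \<in> S")
        by (intro comb uS)
      have "J ?w = J (\<lambda>x. u m x + (-1/2) * u m x) + 2 * (1/2) * (q (\<lambda>x. u m x + (-1/2) * u m x) (u n) - l (u n))
          + (1/2)\<^sup>2 * q (u n) (u n)"
        by (intro J_step comb uS)
      also have "J (\<lambda>x. u m x + (-1/2) * u m x) = J (u m) + 2 * (-1/2) * (q (u m) (u m) - l (u m))
          + (-1/2)\<^sup>2 * q (u m) (u m)"
        by (intro J_step uS)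
      also have "q (\<lambda>x. u m x + (-1/2) * u m x) (u n) = q (u m) (u n) + (-1/2) * q (u m) (u n)"
        by (intro q_lin uS)
      finally have "4 * J ?w = 2 * J (u m) + 2 * J (u n) - q (\<lambda>x. u m x - u n x) (\<lambda>x. u m x - u n x)"
        unfolding D by (simp add: J_def power2_eq_square field_simps)
      moreover have "d \<le> J ?w" using d_le[OF mid] .
      moreover have "inverse (real (Suc m)) \<le> inverse (real (Suc N))" "inverse (real (Suc n)) \<le> inverse (real (Suc N))"
        using that by (auto intro!: le_imp_inverse_le)
      ultimately show ?thesis using uJ[of m] uJ[of n] N by linarith
    qed
    then show "\<exists>N. \<forall>m\<ge>N. \<forall>n\<ge>N. q (\<lambda>x. u m x - u n x) (\<lambda>x. u m x - u n x) < e" by blast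
  next
    fix v assume v: "v \<in> S"
    have bound: "(q (u n) v - l v)\<^sup>2 \<le> (q v v + 1) * inverse (real (Suc n))" for n
    proof -
      define r where "r = q (u n) v - l v"
      \<comment> \<open>The optimal step length is \<open>- r / q v v\<close>; the \<open>+ 1\<close> avoids division by zero.\<close>
      define t where "t = - r / (q v v + 1)"
      have b: "0 \<le> q v v" using q_pos[OF v] .
      have "d \<le> J (\<lambda>x. u n x + t * v x)" by (intro d_le comb uS v)
      also have "\<dots> = J (u n) + 2 * t * r + t\<^sup>2 * q v v"
        unfolding r_def by (rule J_step[OF uS v])
      finally have "0 \<le> inverse (real (Suc n)) + 2 * t * r + t\<^sup>2 * q v v" using uJ[of n] by linarith
      also have "\<dots> \<le> inverse (real (Suc n)) + 2 * t * r + t\<^sup>2 * (q v v + 1)"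
        by (simp add: algebra_simps)
      also have "\<dots> = inverse (real (Suc n)) - r\<^sup>2 / (q v v + 1)"
      proof -
        have "t * (q v v + 1) = - r" using b by (simp add: t_def)
        then have "t\<^sup>2 * (q v v + 1) = - (t * r)" by (metis mult.assoc mult_minus_right power2_eq_square)
        moreover have "t * r = - (r\<^sup>2 / (q v v + 1))" by (simp add: t_def power2_eq_square)
        ultimately show ?thesis by simp
      qed
      finally have "r\<^sup>2 / (q v v + 1) \<le> inverse (real (Suc n))" by simp
      moreover have "0 < q v v + 1" using b by simp
      ultimately show ?thesis unfolding r_def by (simp only: pos_divide_le_eq mult.commute)
    qed
    have "(\<lambda>n. (q v v + 1) * inverse (real (Suc n))) \<longlonglongrightarrow> 0"
      by (intro tendsto_mult_right_zero LIMSEQ_inverse_real_of_nat)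
    with bound have "(\<lambda>n. q (u n) v - l v) \<longlonglongrightarrow> 0"
      by (rule tendsto_0_of_square_le)
    then show "(\<lambda>n. q (u n) v) \<longlonglongrightarrow> l v" by (simp add: LIM_zero_iff)
  qed
qed

section \<open>Square-integrable functions\<close>

definition square_integrable :: "'a measure \<Rightarrow> ('a \<Rightarrow> real) \<Rightarrow> bool" where
  "square_integrable M f \<longleftrightarrow> f \<in> borel_measurable M \<and> integrable M (\<lambda>x. (f x)\<^sup>2)"

lemma square_integrable_square: "square_integrable M f \<Longrightarrow> integrable M (\<lambda>x. (f x)\<^sup>2)"
  by (simp add: square_integrable_def)

lemma square_integrable_mult:
  assumes f: "square_integrable M f" and g: "square_integrable M g"
  shows "integrable M (\<lambda>x. f x * g x)"
proof (rule Bochner_Integration.integrable_bound)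
  show "integrable M (\<lambda>x. (f x)\<^sup>2 + (g x)\<^sup>2)"
    using f g by (simp add: square_integrable_def)
  show "(\<lambda>x. f x * g x) \<in> borel_measurable M"
    using f g by (auto simp: square_integrable_def)
  have "\<bar>a * b\<bar> \<le> a\<^sup>2 + b\<^sup>2" for a b :: real
    using sum_squares_bound[of "\<bar>a\<bar>" "\<bar>b\<bar>"] mult_nonneg_nonneg[of "\<bar>a\<bar>" "\<bar>b\<bar>"]
    by (simp only: abs_mult power2_abs mult.assoc) linarith
  then show "AE x in M. norm (f x * g x) \<le> norm ((f x)\<^sup>2 + (g x)\<^sup>2)"
    by auto
qed

lemma square_integrable_cmult:
  "square_integrable M f \<Longrightarrow> square_integrable M (\<lambda>x. c * f x)"
  by (auto simp: square_integrable_def power_mult_distrib)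

lemma square_integrable_add:
  assumes "square_integrable M f" "square_integrable M g"
  shows "square_integrable M (\<lambda>x. f x + g x)"
  using assms square_integrable_mult[OF assms]
  by (auto simp: square_integrable_def power2_sum mult.assoc)

lemma square_integrable_diff:
  assumes "square_integrable M f" "square_integrable M g"
  shows "square_integrable M (\<lambda>x. f x - g x)"
  using square_integrable_add[OF assms(1) square_integrable_cmult[OF assms(2), of "-1"]] by simp

lemma square_integrable_bounded_mult:
  assumes a: "a \<in> borel_measurable M" "\<And>x. \<bar>a x\<bar> \<le> K" and f: "square_integrable M f"
  shows "square_integrable M (\<lambda>x. a x * f x)"
  unfolding square_integrable_def
proof
  show "(\<lambda>x. a x * f x) \<in> borel_measurable M" using a f by (auto simp: square_integrable_def)
  show "integrable M (\<lambda>x. (a x * f x)\<^sup>2)"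
  proof (rule Bochner_Integration.integrable_bound)
    show "integrable M (\<lambda>x. K\<^sup>2 * (f x)\<^sup>2)" using f by (simp add: square_integrable_def)
    have "\<bar>a x\<bar>\<^sup>2 \<le> K\<^sup>2" for x using a(2)[of x] by (intro power_mono) auto
    then show "AE x in M. norm ((a x * f x)\<^sup>2) \<le> norm (K\<^sup>2 * (f x)\<^sup>2)"
      by (auto simp: power_mult_distrib intro!: mult_right_mono)
  qed (use a f in \<open>auto simp: square_integrable_def\<close>)
qed

lemma (in finite_measure) square_integrable_bounded:
  assumes "f \<in> borel_measurable M" "\<And>x. x \<in> space M \<Longrightarrow> \<bar>f x\<bar> \<le> K"
  shows "square_integrable M f"
  unfolding square_integrable_def
proof
  have "(f x)\<^sup>2 \<le> K\<^sup>2" if "x \<in> space M" for x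
    using power_mono[OF assms(2)[OF that] abs_ge_zero, of 2] by simp
  then show "integrable M (\<lambda>x. (f x)\<^sup>2)" using assms(1)
    by (intro integrable_const_bound[of _ "K\<^sup>2"]) (auto)
qed (rule assms)

lemma (in finite_measure) square_integrable_const: "square_integrable M (\<lambda>x. c)"
  by (rule square_integrable_bounded[of _ "\<bar>c\<bar>"]) auto

lemma (in finite_measure) square_integrable_integrable:
  "square_integrable M f \<Longrightarrow> integrable M f"
  using square_integrable_mult[OF _ square_integrable_const[of 1], of f] by simp

lemma quadratic_nonneg_discriminant:
  fixes a b c :: real
  assumes "\<And>t. 0 \<le> a + 2 * t * b + t\<^sup>2 * c" "0 \<le> c"
  shows "b\<^sup>2 \<le> a * c"
proof (cases "c = 0")
  case True
  have "0 \<le> a + 2 * (-(a+1)/(2*b)) * b" using assms(1)[of "-(a+1)/(2*b)"] True by simp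
  then have "b = 0" using assms(1)[of 0] by (cases "b = 0") (auto simp: field_simps)
  then show ?thesis using True by simp
next
  case False
  have "0 \<le> a + 2 * (-b/c) * b + (-b/c)\<^sup>2 * c" by (rule assms)
  then show ?thesis using False assms(2) by (simp add: power2_eq_square field_simps)
qed

lemma integral_square_comb:
  assumes f: "square_integrable M f" and g: "square_integrable M g"
  shows "(LINT x|M. (f x + t * g x)\<^sup>2)
    = (LINT x|M. (f x)\<^sup>2) + 2 * t * (LINT x|M. f x * g x) + t\<^sup>2 * (LINT x|M. (g x)\<^sup>2)"
proof -
  have "(f x + t * g x)\<^sup>2 = (f x)\<^sup>2 + 2 * t * (f x * g x) + t\<^sup>2 * (g x)\<^sup>2" for x
    by (simp add: power2_eq_square algebra_simps)
  then show ?thesis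
    using f g square_integrable_mult[OF f g] by (simp add: square_integrable_def)
qed

lemma L2_Cauchy_Schwarz:
  assumes f: "square_integrable M f" and g: "square_integrable M g"
  shows "(LINT x|M. f x * g x)\<^sup>2 \<le> (LINT x|M. (f x)\<^sup>2) * (LINT x|M. (g x)\<^sup>2)"
proof (rule quadratic_nonneg_discriminant)
  fix t
  show "0 \<le> (LINT x|M. (f x)\<^sup>2) + 2 * t * (LINT x|M. f x * g x) + t\<^sup>2 * (LINT x|M. (g x)\<^sup>2)"
    unfolding integral_square_comb[OF f g, symmetric] by simp
qed simp

lemma integral_square_add_le:
  assumes f: "square_integrable M f" and g: "square_integrable M g"
  shows "(LINT x|M. (f x + g x)\<^sup>2) \<le> 2 * (LINT x|M. (f x)\<^sup>2) + 2 * (LINT x|M. (g x)\<^sup>2)"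
proof -
  have "0 \<le> (LINT x|M. (f x - g x)\<^sup>2)" by simp
  then show ?thesis
    using integral_square_comb[OF f g, of 1] integral_square_comb[OF f g, of "-1"] by (simp, linarith)
qed

definition L2_tendsto :: "'a measure \<Rightarrow> (nat \<Rightarrow> 'a \<Rightarrow> real) \<Rightarrow> ('a \<Rightarrow> real) \<Rightarrow> bool" where
  "L2_tendsto M f g \<longleftrightarrow> (\<lambda>n. LINT x|M. (f n x - g x)\<^sup>2) \<longlonglongrightarrow> 0"

definition L2_Cauchy :: "'a measure \<Rightarrow> (nat \<Rightarrow> 'a \<Rightarrow> real) \<Rightarrow> bool" where
  "L2_Cauchy M f \<longleftrightarrow> (\<forall>e>0. \<exists>N. \<forall>m\<ge>N. \<forall>n\<ge>N. (LINT x|M. (f m x - f n x)\<^sup>2) < e)"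

lemma L2_tendsto_inner:
  assumes f: "\<And>n. square_integrable M (f n)" and g: "square_integrable M g"
    and h: "square_integrable M h" and lim: "L2_tendsto M f g"
  shows "(\<lambda>n. LINT x|M. f n x * h x) \<longlonglongrightarrow> (LINT x|M. g x * h x)"
proof -
  have le: "(LINT x|M. (f n x - g x) * h x)\<^sup>2 \<le> (LINT x|M. (f n x - g x)\<^sup>2) * (LINT x|M. (h x)\<^sup>2)" for n
    by (intro L2_Cauchy_Schwarz square_integrable_diff f g h)
  have "(\<lambda>n. (LINT x|M. (f n x - g x)\<^sup>2) * (LINT x|M. (h x)\<^sup>2)) \<longlonglongrightarrow> 0"
    using lim unfolding L2_tendsto_def by (rule tendsto_mult_left_zero)
  with le have "(\<lambda>n. LINT x|M. (f n x - g x) * h x) \<longlonglongrightarrow> 0"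
    by (rule tendsto_0_of_square_le)
  moreover have "(LINT x|M. (f n x - g x) * h x) = (LINT x|M. f n x * h x) - (LINT x|M. g x * h x)" for n
    using square_integrable_mult[OF f h] square_integrable_mult[OF g h] by (simp add: left_diff_distrib)
  ultimately show ?thesis by (simp add: LIM_zero_iff)
qed

lemma L2_tendsto_Cauchy:
  assumes f: "\<And>n. square_integrable M (f n)" and g: "square_integrable M g"
    and lim: "L2_tendsto M f g"
  shows "L2_Cauchy M f"
  unfolding L2_Cauchy_def
proof (intro allI impI)
  fix e :: real assume "0 < e"
  then obtain N where N: "\<And>n. N \<le> n \<Longrightarrow> (LINT x|M. (f n x - g x)\<^sup>2) < e / 4"
    using order_tendstoD(2)[OF lim[unfolded L2_tendsto_def], of "e/4"] by (auto simp: eventually_sequentially)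
  have "(LINT x|M. (f m x - f n x)\<^sup>2) < e" if "N \<le> m" "N \<le> n" for m n
  proof -
    have "(LINT x|M. (f m x - f n x)\<^sup>2) = (LINT x|M. ((f m x - g x) + (g x - f n x))\<^sup>2)" by simp
    also have "\<dots> \<le> 2 * (LINT x|M. (f m x - g x)\<^sup>2) + 2 * (LINT x|M. (g x - f n x)\<^sup>2)"
      by (intro integral_square_add_le square_integrable_diff f g)
    also have "(LINT x|M. (g x - f n x)\<^sup>2) = (LINT x|M. (f n x - g x)\<^sup>2)" by (simp add: power2_commute)
    finally show ?thesis using N[OF that(1)] N[OF that(2)] by linarith
  qed
  then show "\<exists>N. \<forall>m\<ge>N. \<forall>n\<ge>N. (LINT x|M. (f m x - f n x)\<^sup>2) < e" by blast
qed

lemma L2_tendsto_unique: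
  assumes f: "\<And>n. square_integrable M (f n)"
    and g: "square_integrable M g" "L2_tendsto M f g"
    and h: "square_integrable M h" "L2_tendsto M f h"
  shows "AE x in M. g x = h x"
proof -
  have le: "(LINT x|M. (g x - h x)\<^sup>2) \<le> 2 * (LINT x|M. (f n x - g x)\<^sup>2) + 2 * (LINT x|M. (f n x - h x)\<^sup>2)" for n
  proof -
    have "(LINT x|M. (g x - h x)\<^sup>2) = (LINT x|M. ((g x - f n x) + (f n x - h x))\<^sup>2)" by simp
    also have "\<dots> \<le> 2 * (LINT x|M. (g x - f n x)\<^sup>2) + 2 * (LINT x|M. (f n x - h x)\<^sup>2)"
      by (intro integral_square_add_le square_integrable_diff f g h)
    finally show ?thesis by (simp add: power2_commute)
  qed
  have "(\<lambda>n. 2 * (LINT x|M. (f n x - g x)\<^sup>2) + 2 * (LINT x|M. (f n x - h x)\<^sup>2)) \<longlonglongrightarrow> 2 * 0 + 2 * 0"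
    using g(2) h(2) unfolding L2_tendsto_def by (intro tendsto_intros)
  then have "(LINT x|M. (g x - h x)\<^sup>2) \<le> 0" using le
    by (intro LIMSEQ_le_const[of _ 0]) auto
  then have "(LINT x|M. (g x - h x)\<^sup>2) = 0" by (simp add: order_antisym)
  then have "AE x in M. (g x - h x)\<^sup>2 = 0"
    using square_integrable_square[OF square_integrable_diff[OF g(1) h(1)]]
    by (subst (asm) integral_nonneg_eq_0_iff_AE) auto
  then show ?thesis by simp
qed

text \<open>
  The Riesz-Fischer argument: along a subsequence the increments are summable in \<open>L\<^sup>1\<close>, which on a finite
  measure space is weaker than \<open>L\<^sup>2\<close>, so that the subsequence converges a.e.; Fatou's lemma turns this into
  convergence of the whole sequence.
\<close>

lemma (in finite_measure) L2_complete:
  assumes f: "\<And>n. square_integrable M (f n)" and Cau: "L2_Cauchy M f"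
  obtains g where "square_integrable M g" "L2_tendsto M f g"
proof -
  have fm [measurable]: "f n \<in> borel_measurable M" for n using f by (simp add: square_integrable_def)
  have "\<exists>N. \<forall>m\<ge>N. \<forall>n\<ge>N. (LINT x|M. (f m x - f n x)\<^sup>2) < (1/4)^k" for k
    using Cau unfolding L2_Cauchy_def by simp
  then obtain N where N: "\<And>k m n. N k \<le> m \<Longrightarrow> N k \<le> n \<Longrightarrow> (LINT x|M. (f m x - f n x)\<^sup>2) < (1/4)^k"
    by metis
  \<comment> \<open>Indices past \<open>N k\<close> that also increase with \<open>k\<close>.\<close>
  define r where "r k = k + (\<Sum>i\<le>k. N i)" for k
  have rN: "N k \<le> r k" for k unfolding r_def by (simp add: member_le_sum trans_le_add2)
  have rS: "r k \<le> r (Suc k)" for k unfolding r_def by simp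
  have rk: "k \<le> r k" for k unfolding r_def by simp
  define D where "D k x = f (r (Suc k)) x - f (r k) x" for k x
  have Dsq: "square_integrable M (D k)" for k unfolding D_def by (intro square_integrable_diff f)
  have D1: "(LINT x|M. \<bar>D k x\<bar>) \<le> sqrt (measure M (space M)) * (1/2)^k" for k
  proof -
    have sq: "square_integrable M (\<lambda>x. \<bar>D k x\<bar>)" using Dsq[of k] by (auto simp: square_integrable_def)
    have "(LINT x|M. \<bar>D k x\<bar> * 1)\<^sup>2 \<le> (LINT x|M. \<bar>D k x\<bar>\<^sup>2) * (LINT x|M. 1\<^sup>2)"
      by (intro L2_Cauchy_Schwarz sq square_integrable_const)
    also have "\<dots> \<le> (1/4)^k * measure M (space M)"
      using N[of k "r (Suc k)" "r k"] rN[of k] rS[of k]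
      by (auto simp: D_def intro!: mult_right_mono)
    also have "\<dots> = (sqrt (measure M (space M)) * (1/2)^k)\<^sup>2"
    proof -
      have "((1/2)^k)\<^sup>2 = ((1/4)^k :: real)" by (simp add: power2_eq_square power_mult_distrib[symmetric])
      then show ?thesis by (simp add: power_mult_distrib)
    qed
    finally have "\<bar>LINT x|M. \<bar>D k x\<bar> * 1\<bar> \<le> \<bar>sqrt (measure M (space M)) * (1/2)^k\<bar>"
      by (simp only: abs_le_square_iff)
    then show ?thesis by simp
  qed
  have Dint: "integrable M (D k)" for k using Dsq by (rule square_integrable_integrable)
  have "AE x in M. summable (\<lambda>k. \<bar>D k x\<bar>)"
  proof -
    have "(\<integral>\<^sup>+x. (\<Sum>k. ennreal \<bar>D k x\<bar>) \<partial>M) = (\<Sum>k. \<integral>\<^sup>+x. ennreal \<bar>D k x\<bar> \<partial>M)"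
      unfolding D_def by (intro nn_integral_suminf) measurable
    also have "\<dots> = (\<Sum>k. ennreal (LINT x|M. \<bar>D k x\<bar>))"
      by (intro arg_cong[where f=suminf] ext nn_integral_eq_integral integrable_abs Dint) auto
    also have "\<dots> \<le> (\<Sum>k. ennreal (sqrt (measure M (space M)) * (1/2)^k))"
      by (intro suminf_le ennreal_leI D1) auto
    also have "\<dots> < \<infinity>"
    proof -
      have "(\<Sum>k. ennreal (sqrt (measure M (space M)) * (1/2)^k)) \<noteq> top"
        by (rule ennreal_suminf_neq_top) (auto intro!: summable_mult summable_geometric)
      then show ?thesis by (simp add: less_top)
    qed
    finally have "AE x in M. (\<Sum>k. ennreal \<bar>D k x\<bar>) \<noteq> \<infinity>"
      by (intro nn_integral_noteq_infinite) (auto simp: D_def)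
    then show ?thesis
      by eventually_elim (auto intro: summable_suminf_not_top)
  qed
  then have conv: "AE x in M. convergent (\<lambda>k. f (r k) x)"
  proof eventually_elim
    case (elim x)
    then have "summable (\<lambda>k. D k x)" by (rule summable_rabs_cancel)
    then have "convergent (\<lambda>n. \<Sum>k<n. D k x)" by (simp add: summable_iff_convergent)
    moreover have "(\<Sum>k<n. D k x) = f (r n) x - f (r 0) x" for n
      unfolding D_def by (rule sum_lessThan_telescope)
    ultimately have "convergent (\<lambda>n. f (r n) x - f (r 0) x)" by simp
    then have "convergent (\<lambda>n. (f (r n) x - f (r 0) x) + f (r 0) x)"
      using convergent_add[OF _ convergent_const] by blast
    then show ?case by simp
  qed
  define g where "g x = lim (\<lambda>k. f (r k) x)" for x
  have gm [measurable]: "g \<in> borel_measurable M" unfolding g_def by measurable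
  have glim: "AE x in M. (\<lambda>k. f (r k) x) \<longlonglongrightarrow> g x"
    using conv by eventually_elim (simp add: g_def convergent_LIMSEQ_iff)
  have fatou: "(\<integral>\<^sup>+x. ennreal ((f n x - g x)\<^sup>2) \<partial>M) \<le> ennreal e"
    if e: "0 < e" and n: "\<And>m. N0 \<le> m \<Longrightarrow> (LINT x|M. (f n x - f m x)\<^sup>2) < e" for n N0 e
  proof -
    have "(\<integral>\<^sup>+x. ennreal ((f n x - g x)\<^sup>2) \<partial>M) = (\<integral>\<^sup>+x. liminf (\<lambda>k. ennreal ((f n x - f (r k) x)\<^sup>2)) \<partial>M)"
    proof (rule nn_integral_cong_AE)
      show "AE x in M. ennreal ((f n x - g x)\<^sup>2) = liminf (\<lambda>k. ennreal ((f n x - f (r k) x)\<^sup>2))"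
        using glim
      proof eventually_elim
        case (elim x)
        then have "(\<lambda>k. ennreal ((f n x - f (r k) x)\<^sup>2)) \<longlonglongrightarrow> ennreal ((f n x - g x)\<^sup>2)"
          by (intro tendsto_ennrealI tendsto_intros)
        then show ?case by (metis lim_imp_Liminf sequentially_bot)
      qed
    qed
    also have "\<dots> \<le> liminf (\<lambda>k. \<integral>\<^sup>+x. ennreal ((f n x - f (r k) x)\<^sup>2) \<partial>M)"
      by (intro nn_integral_liminf) measurable
    also have "\<dots> = liminf (\<lambda>k. ennreal (LINT x|M. (f n x - f (r k) x)\<^sup>2))"
      by (intro arg_cong[where f=liminf] ext nn_integral_eq_integral square_integrable_square square_integrable_diff f) auto
    also have "\<dots> \<le> ennreal e"
    proof (rule Liminf_le)
      show "\<forall>\<^sub>F k in sequentially. ennreal (LINT x|M. (f n x - f (r k) x)\<^sup>2) \<le> ennreal e"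
        unfolding eventually_sequentially
      proof (intro exI[of _ N0] allI impI)
        fix k assume "N0 \<le> k"
        then have "N0 \<le> r k" using rk[of k] by simp
        from n[OF this] show "ennreal (LINT x|M. (f n x - f (r k) x)\<^sup>2) \<le> ennreal e"
          by (intro ennreal_leI) simp
      qed
    qed simp
    finally show ?thesis .
  qed
  have sqd: "square_integrable M (\<lambda>x. f n x - g x) \<and> (LINT x|M. (f n x - g x)\<^sup>2) \<le> e"
    if e: "0 < e" and n: "\<And>m. N0 \<le> m \<Longrightarrow> (LINT x|M. (f n x - f m x)\<^sup>2) < e" for n N0 e
  proof -
    have fin: "(\<integral>\<^sup>+x. ennreal ((f n x - g x)\<^sup>2) \<partial>M) \<le> ennreal e" by (rule fatou[OF e n])
    then have int: "integrable M (\<lambda>x. (f n x - g x)\<^sup>2)"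
      by (intro integrableI_nonneg) (auto simp: less_top[symmetric] top_unique)
    have "ennreal (LINT x|M. (f n x - g x)\<^sup>2) \<le> ennreal e"
      using fin nn_integral_eq_integral[OF int] by simp
    then show ?thesis using int e by (auto simp: square_integrable_def ennreal_le_iff)
  qed
  have "square_integrable M (\<lambda>x. f (N 0) x - g x)"
    using sqd[of 1 "N 0" "N 0"] N[of 0 "N 0"] by simp
  from square_integrable_diff[OF f[of "N 0"] this] have g: "square_integrable M g" by simp
  have "L2_tendsto M f g"
    unfolding L2_tendsto_def
  proof (rule LIMSEQ_I)
    fix e :: real assume "0 < e"
    then obtain N0 where N0: "\<And>m n. N0 \<le> m \<Longrightarrow> N0 \<le> n \<Longrightarrow> (LINT x|M. (f m x - f n x)\<^sup>2) < e/2"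
      using Cau unfolding L2_Cauchy_def by (metis half_gt_zero)
    have "norm ((LINT x|M. (f n x - g x)\<^sup>2) - 0) < e" if "N0 \<le> n" for n
      using sqd[of "e/2" N0 n] N0[OF that] \<open>0 < e\<close> by simp
    then show "\<exists>no. \<forall>n\<ge>no. norm ((LINT x|M. (f n x - g x)\<^sup>2) - 0) < e" by blast
  qed
  with g show ?thesis by (rule that)
qed

section \<open>The fundamental theorem of calculus for lateral derivatives\<close>

lemma eventually_left_increment:
  fixes x :: real
  assumes "\<forall>\<^sub>F h in at_left 0. P (x + h)"
  shows "\<forall>\<^sub>F y in at_left x. P y"
proof -
  obtain b where b: "b < 0" "\<And>h. b < h \<Longrightarrow> h < 0 \<Longrightarrow> P (x + h)"
    using assms unfolding eventually_at_left_field by auto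
  have "P y" if "b + x < y" "y < x" for y
    using b(2)[of "y - x"] that by simp
  then show ?thesis unfolding eventually_at_left_field
    using b(1) by (intro exI[of _ "b + x"]) auto
qed

text \<open>
  The mean value argument behind the fundamental theorem. Starting from \<open>b\<close>, the set of points down to which
  \<open>\<bar>\<psi> b - \<psi> z\<bar> \<le> e * (W b - W z)\<close> persists is closed at its lower end by right continuity, and can be
  extended to the left by the hypothesis on left increments; so it reaches \<open>a\<close>. The one-sided
  hypotheses match this direction of travel.
\<close>

lemma left_derivative_zero_imp_eq:
  fixes \<psi> W :: "real \<Rightarrow> real"
  assumes ab: "a \<le> b" and W: "mono W"
    and rc: "\<And>x. a \<le> x \<Longrightarrow> x < b \<Longrightarrow> continuous (at_right x) \<psi>"
      "\<And>x. continuous (at_right x) W"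
    and zero: "\<And>x e. a < x \<Longrightarrow> x \<le> b \<Longrightarrow> 0 < e \<Longrightarrow>
      \<forall>\<^sub>F y in at_left x. \<bar>\<psi> x - \<psi> y\<bar> \<le> e * (W x - W y)"
  shows "\<psi> b = \<psi> a"
proof -
  have bound: "\<bar>\<psi> b - \<psi> a\<bar> \<le> e * (W b - W a)" if e: "0 < e" for e
  proof -
    define T where "T = {y\<in>{a..b}. \<forall>z\<in>{y..b}. \<bar>\<psi> b - \<psi> z\<bar> \<le> e * (W b - W z)}"
    define s where "s = Inf T"
    have bT: "b \<in> T" using ab by (auto simp: T_def)
    have bdd: "bdd_below T" by (rule bdd_belowI[of _ a]) (auto simp: T_def)
    have sb: "s \<le> b" unfolding s_def using bT bdd by (rule cInf_lower)
    have as: "a \<le> s" unfolding s_def using bT by (intro cInf_greatest) (auto simp: T_def)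
    have above: "\<bar>\<psi> b - \<psi> z\<bar> \<le> e * (W b - W z)" if "s < z" "z \<le> b" for z
    proof -
      have "T \<noteq> {}" "Inf T < z" using bT that(1) by (auto simp: s_def)
      from cInf_lessD[OF this] obtain t where "t \<in> T" "t < z" by blast
      then show ?thesis using that(2) by (auto simp: T_def)
    qed
    have at_s: "\<bar>\<psi> b - \<psi> s\<bar> \<le> e * (W b - W s)"
    proof (cases "s = b")
      case False
      then have "s < b" using sb by simp
      then have "\<forall>\<^sub>F z in at_right s. \<bar>\<psi> b - \<psi> z\<bar> \<le> e * (W b - W z)"
        unfolding eventually_at_right_field using above by (intro exI[of _ b]) auto
      moreover have "(\<psi> \<longlongrightarrow> \<psi> s) (at_right s)" "(W \<longlongrightarrow> W s) (at_right s)"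
        using rc(1)[OF as \<open>s < b\<close>] rc(2) by (auto simp: continuous_within)
      then have "((\<lambda>z. \<bar>\<psi> b - \<psi> z\<bar>) \<longlongrightarrow> \<bar>\<psi> b - \<psi> s\<bar>) (at_right s)"
        "((\<lambda>z. e * (W b - W z)) \<longlongrightarrow> e * (W b - W s)) (at_right s)"
        by (auto intro!: tendsto_intros)
      ultimately show ?thesis by (intro tendsto_le[of "at_right s"]) auto
    qed simp
    have "\<not> a < s"
    proof
      assume "a < s"
      from zero[OF this sb e] obtain c where c: "c < s"
        "\<And>y. c < y \<Longrightarrow> y < s \<Longrightarrow> \<bar>\<psi> s - \<psi> y\<bar> \<le> e * (W s - W y)"
        unfolding eventually_at_left_field by auto
      define y where "y = max a ((c + s) / 2)"
      have y: "y < s" "c < y" "a \<le> y" using c(1) \<open>a < s\<close> by (auto simp: y_def less_max_iff_disj)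
      have "\<bar>\<psi> b - \<psi> z\<bar> \<le> e * (W b - W z)" if "y \<le> z" "z \<le> b" for z
      proof (cases "z < s")
        case True
        then have "\<bar>\<psi> s - \<psi> z\<bar> \<le> e * (W s - W z)" using c(2) y that by simp
        then have "\<bar>\<psi> b - \<psi> z\<bar> \<le> e * (W b - W s) + e * (W s - W z)" using at_s by linarith
        then show ?thesis by (simp add: algebra_simps)
      next
        case False
        then show ?thesis using above at_s that by (cases "z = s") auto
      qed
      then have "y \<in> T" using y sb by (auto simp: T_def)
      then have "s \<le> y" unfolding s_def using bdd by (rule cInf_lower)
      then show False using y by simp
    qed
    then show ?thesis using as at_s by simp
  qed
  show ?thesis
  proof (rule ccontr)
    assume "\<psi> b \<noteq> \<psi> a"
    then have p: "0 < \<bar>\<psi> b - \<psi> a\<bar>" by simp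
    have W0: "0 \<le> W b - W a" using W ab by (simp add: mono_def)
    define e where "e = \<bar>\<psi> b - \<psi> a\<bar> / (W b - W a + 1)"
    have "0 < e" using p W0 by (simp add: e_def)
    have "e * (W b - W a + 1) = \<bar>\<psi> b - \<psi> a\<bar>" using W0 by (simp add: e_def)
    moreover have "e * (W b - W a) < e * (W b - W a + 1)" using \<open>0 < e\<close> by simp
    ultimately show False using bound[OF \<open>0 < e\<close>] by simp
  qed
qed

text \<open>
  The function is a pointwise limit of step functions that sample it on a grid strictly to the left.
\<close>

lemma left_continuous_borel_measurable:
  fixes f :: "real \<Rightarrow> real"
  assumes "\<And>x. continuous (at_left x) f"
  shows "f \<in> borel_measurable borel"
proof (rule borel_measurable_LIMSEQ_real)
  \<comment> \<open>The ceiling minus one, rather than the floor, keeps the sample point strictly left of \<open>x\<close> at grid points.\<close>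
  define d where "d n x = real_of_int (\<lceil>real (Suc n) * x\<rceil> - 1) / real (Suc n)" for n x
  have d_less: "d n x < x" for n x
  proof -
    have "real_of_int (\<lceil>real (Suc n) * x\<rceil> - 1) < real (Suc n) * x" by linarith
    then show ?thesis unfolding d_def by (simp only: pos_divide_less_eq of_nat_0_less_iff zero_less_Suc mult.commute)
  qed
  have d_ge: "x - inverse (real (Suc n)) \<le> d n x" for n x
  proof -
    have "real (Suc n) * x - 1 \<le> real_of_int (\<lceil>real (Suc n) * x\<rceil> - 1)" by linarith
    then have "(real (Suc n) * x - 1) / real (Suc n) \<le> d n x"
      unfolding d_def by (rule divide_right_mono) simp
    moreover have "(real (Suc n) * x - 1) / real (Suc n) = x - inverse (real (Suc n))"
      by (simp add: diff_divide_distrib inverse_eq_divide)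
    ultimately show ?thesis by simp
  qed
  show "(\<lambda>n. f (d n x)) \<longlonglongrightarrow> f x" for x
  proof -
    have "(\<lambda>n. x - inverse (real (Suc n))) \<longlonglongrightarrow> x"
      using tendsto_diff[OF tendsto_const LIMSEQ_inverse_real_of_nat, of x] by simp
    then have "(\<lambda>n. d n x) \<longlonglongrightarrow> x"
      by (rule real_tendsto_sandwich[OF _ _ _ tendsto_const, rotated 2])
        (use d_ge less_imp_le[OF d_less] in \<open>simp_all\<close>)
    then have "filterlim (\<lambda>n. d n x) (at_left x) sequentially"
      using d_less by (simp add: filterlim_at less_imp_neq)
    moreover have "(f \<longlongrightarrow> f x) (at_left x)" using assms by (simp add: continuous_within)
    ultimately show ?thesis by (rule filterlim_compose[rotated])
  qed
  show "(\<lambda>x. f (d n x)) \<in> borel_measurable borel" for n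
  proof -
    have "(\<lambda>x. \<lceil>real (Suc n) * x\<rceil>) \<in> measurable borel (count_space UNIV)" by measurable
    then show ?thesis unfolding d_def
      by (rule measurable_compose) simp
  qed
qed

text \<open>
  The one-sided limits bound the function near each point, and bisection makes this bound global.
\<close>

lemma caglad_bounded:
  assumes f: "caglad f" and ab: "a \<le> b"
  shows "\<exists>K. \<forall>x\<in>{a..b}. \<bar>f x\<bar> \<le> K"
proof -
  define P where "P = (\<lambda>a b. \<exists>K. \<forall>x\<in>{a..b}. \<bar>f x\<bar> \<le> K)"
  have "P a b"
    using ab
  proof (rule Bolzano)
    fix a b c :: real
    assume "P a b" "P b c" and abc: "a \<le> b" "b \<le> c"
    then obtain K1 K2 where K: "\<forall>x\<in>{a..b}. \<bar>f x\<bar> \<le> K1" "\<forall>x\<in>{b..c}. \<bar>f x\<bar> \<le> K2"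
      unfolding P_def by blast
    have "\<bar>f x\<bar> \<le> max K1 K2" if "x \<in> {a..c}" for x
      using K that by (cases "x \<le> b") (auto simp: le_max_iff_disj)
    then show "P a c" unfolding P_def by blast
  next
    fix x :: real
    obtain l where l: "(f \<longlongrightarrow> l) (at_right x)" and fx: "(f \<longlongrightarrow> f x) (at_left x)"
      using f by (auto simp: caglad_def continuous_within)
    have near: "\<forall>\<^sub>F y in F. \<bar>f y\<bar> \<le> \<bar>m\<bar> + 1" if "(f \<longlongrightarrow> m) F" for m F
      using tendstoD[OF that zero_less_one] by eventually_elim (auto simp: dist_real_def)
    obtain p where p: "x < p" "\<And>y. x < y \<Longrightarrow> y < p \<Longrightarrow> \<bar>f y\<bar> \<le> \<bar>l\<bar> + 1"
      using near[OF l] unfolding eventually_at_right_field by auto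
    obtain q where q: "q < x" "\<And>y. q < y \<Longrightarrow> y < x \<Longrightarrow> \<bar>f y\<bar> \<le> \<bar>f x\<bar> + 1"
      using near[OF fx] unfolding eventually_at_left_field by auto
    show "\<exists>d>0. \<forall>a b. a \<le> x \<and> x \<le> b \<and> b - a < d \<longrightarrow> P a b"
    proof (intro exI[of _ "min (p - x) (x - q)"] conjI allI impI)
      show "0 < min (p - x) (x - q)" using p q by simp
      fix a b assume ab: "a \<le> x \<and> x \<le> b \<and> b - a < min (p - x) (x - q)"
      have "\<bar>f y\<bar> \<le> \<bar>l\<bar> + \<bar>f x\<bar> + 1" if "y \<in> {a..b}" for y
      proof -
        consider "y < x" | "y = x" | "x < y" by linarith
        then show ?thesis
        proof cases
          case 1 then show ?thesis using q(2)[of y] ab that by auto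
        next
          case 2 then show ?thesis by simp
        next
          case 3 then show ?thesis using p(2)[of y] ab that by auto
        qed
      qed
      then show "P a b" unfolding P_def by blast
    qed
  qed
  then show ?thesis by (simp add: P_def)
qed

lemma caglad_borel_measurable: "caglad f \<Longrightarrow> f \<in> borel_measurable borel"
  by (rule left_continuous_borel_measurable) (simp add: caglad_def)

lemma
  fixes W \<Phi> :: "real \<Rightarrow> real"
  assumes W: "mono W" "\<And>x. continuous (at_right x) W"
    and meas: "\<Phi> \<in> borel_measurable borel" and bnd: "\<And>x. x \<in> {y<..z} \<Longrightarrow> \<bar>\<Phi> x\<bar> \<le> K"
  shows set_integrable_interval_measure_Ioc: "set_integrable (interval_measure W) {y<..z} \<Phi>"
    and set_integral_interval_measure_Ioc_le: "y \<le> z \<Longrightarrow>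
      \<bar>LINT x:{y<..z}|interval_measure W. \<Phi> x\<bar> \<le> K * (W z - W y)"
proof -
  have em: "emeasure (interval_measure W) {y<..z} < \<infinity>"
    using emeasure_interval_measure_Ioc_eq[of W y z] W by (simp add: mono_def)
  show int: "set_integrable (interval_measure W) {y<..z} \<Phi>"
    unfolding set_integrable_def
  proof (rule integrableI_bounded_set_indicator[of _ _ _ K])
    show "AE x in interval_measure W. x \<in> {y<..z} \<longrightarrow> norm (\<Phi> x) \<le> K" using bnd by auto
  qed (use em meas in auto)
  assume yz: "y \<le> z"
  have cint: "set_integrable (interval_measure W) {y<..z} (\<lambda>x. K)"
    using em by (simp add: set_integrable_def)
  have "\<bar>LINT x:{y<..z}|interval_measure W. \<Phi> x\<bar> \<le> (LINT x:{y<..z}|interval_measure W. \<bar>\<Phi> x\<bar>)"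
    using set_integral_norm_bound[OF int] by simp
  also have "\<dots> \<le> (LINT x:{y<..z}|interval_measure W. K)"
    by (intro set_integral_mono set_integrable_abs int cint) (use bnd in auto)
  also have "\<dots> = K * (W z - W y)"
    using em measure_interval_measure_Ioc[of y z W] W yz by (simp add: set_integral_const mono_def mult.commute)
  finally show "\<bar>LINT x:{y<..z}|interval_measure W. \<Phi> x\<bar> \<le> K * (W z - W y)" .
qed

text \<open>
  The difference between \<open>\<phi>\<close> and the primitive of \<open>\<Phi>\<close> is right continuous and has vanishing left derivative:
  over \<open>{y<..x}\<close> with \<open>y\<close> close to \<open>x\<close>, left continuity makes \<open>\<Phi>\<close> nearly \<open>\<Phi> x\<close>, including at the
  atom that \<open>x\<close> may carry.
\<close>

theorem left_derivative_FTC: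
  fixes W \<phi> \<Phi> :: "real \<Rightarrow> real"
  assumes W: "strict_mono W" "\<And>x. continuous (at_right x) W"
    and \<phi>: "\<And>x. continuous (at_right x) \<phi>"
    and deriv: "\<And>x. has_left_DW W \<phi> x (\<Phi> x)" and \<Phi>: "caglad \<Phi>"
    and ab: "a \<le> b"
  shows "(LINT x:{a<..b}|interval_measure W. \<Phi> x) = \<phi> b - \<phi> a"
proof -
  let ?M = "interval_measure W"
  have Wm: "mono W" using W(1) by (rule strict_mono_mono)
  have meas: "\<Phi> \<in> borel_measurable borel" using \<Phi> by (rule caglad_borel_measurable)
  obtain K where K: "\<And>x. x \<in> {a..b} \<Longrightarrow> \<bar>\<Phi> x\<bar> \<le> K" using caglad_bounded[OF \<Phi> ab] by blast
  define I where "I y z = (LINT x:{y<..z}|?M. \<Phi> x)" for y z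
  have int: "set_integrable ?M {y<..z} \<Phi>" if "a \<le> y" "z \<le> b" for y z
    using that by (intro set_integrable_interval_measure_Ioc[OF Wm W(2) meas, of _ _ K] K) auto
  have I_add: "I a z = I a y + I y z" if "a \<le> y" "y \<le> z" "z \<le> b" for y z
  proof -
    have "{a<..z} = {a<..y} \<union> {y<..z}" using that by auto
    then show ?thesis unfolding I_def
      using that by (simp add: set_integral_Un[OF _ int int])
  qed
  have I_le: "\<bar>I y z\<bar> \<le> K * (W z - W y)" if "a \<le> y" "y \<le> z" "z \<le> b" for y z
    unfolding I_def using that
    by (intro set_integral_interval_measure_Ioc_le[OF Wm W(2) meas]) (auto intro!: K)
  have I_near: "\<bar>I y z - c * (W z - W y)\<bar> \<le> e * (W z - W y)"
    if "a \<le> y" "y \<le> z" "z \<le> b" and e: "\<And>x. x \<in> {y<..z} \<Longrightarrow> \<bar>\<Phi> x - c\<bar> \<le> e" for y z c e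
  proof -
    have cint: "set_integrable ?M {y<..z} (\<lambda>x. c)"
      by (rule set_integrable_interval_measure_Ioc[OF Wm W(2), of _ _ _ "\<bar>c\<bar>"]) auto
    have "emeasure ?M {y<..z} \<noteq> \<infinity>"
      using emeasure_interval_measure_Ioc_eq[of W y z] W Wm by (simp add: mono_def)
    then have "(LINT x:{y<..z}|?M. c) = c * (W z - W y)"
      using measure_interval_measure_Ioc[of y z W] W Wm that(2)
      by (simp add: set_integral_const mono_def mult.commute)
    moreover have "(LINT x:{y<..z}|?M. \<Phi> x - c) = I y z - (LINT x:{y<..z}|?M. c)"
      unfolding I_def using that by (intro set_integral_diff int cint) auto
    moreover have "\<bar>LINT x:{y<..z}|?M. \<Phi> x - c\<bar> \<le> e * (W z - W y)"
      using that meas by (intro set_integral_interval_measure_Ioc_le[OF Wm W(2)]) auto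
    ultimately show ?thesis by simp
  qed
  define \<psi> where "\<psi> y = \<phi> y - I a y" for y
  have "\<psi> b = \<psi> a"
  proof (rule left_derivative_zero_imp_eq[OF ab Wm _ W(2)])
    fix x assume x: "a \<le> x" "x < b"
    have "((\<lambda>y. K * (W y - W x)) \<longlongrightarrow> K * (W x - W x)) (at_right x)"
      using W(2)[of x] by (intro tendsto_intros) (simp add: continuous_within)
    then have "((\<lambda>y. K * (W y - W x)) \<longlongrightarrow> 0) (at_right x)" by simp
    moreover have "\<forall>\<^sub>F y in at_right x. norm (I x y) \<le> K * (W y - W x)"
      unfolding eventually_at_right_field using x I_le by (intro exI[of _ b]) auto
    ultimately have "((\<lambda>y. I x y) \<longlongrightarrow> 0) (at_right x)" by (rule Lim_null_comparison[rotated])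
    then have "((\<lambda>y. \<phi> y - (I a x + I x y)) \<longlongrightarrow> \<phi> x - (I a x + 0)) (at_right x)"
      using \<phi>[of x] by (intro tendsto_intros) (simp_all add: continuous_within)
    moreover have "\<forall>\<^sub>F y in at_right x. \<phi> y - (I a x + I x y) = \<psi> y"
      unfolding eventually_at_right_field
    proof (intro exI[of _ b] conjI allI impI x(2))
      fix y assume "x < y" "y < b"
      then show "\<phi> y - (I a x + I x y) = \<psi> y" using I_add[of x y] x(1) by (simp add: \<psi>_def)
    qed
    ultimately have "(\<psi> \<longlongrightarrow> \<phi> x - (I a x + 0)) (at_right x)"
      by (rule Lim_transform_eventually)
    then have "(\<psi> \<longlongrightarrow> \<psi> x) (at_right x)" by (simp add: \<psi>_def)
    then show "continuous (at_right x) \<psi>" by (simp add: continuous_within)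
  next
    fix x e :: real assume x: "a < x" "x \<le> b" and e: "0 < e"
    have "\<forall>\<^sub>F h in at_left 0. dist ((\<phi> (x + h) - \<phi> x) / (W (x + h) - W x)) (\<Phi> x) < e / 2"
      using deriv[of x] e unfolding has_left_DW_def by (intro tendstoD) auto
    then have ev1: "\<forall>\<^sub>F y in at_left x. dist ((\<phi> y - \<phi> x) / (W y - W x)) (\<Phi> x) < e / 2"
      by (rule eventually_left_increment)
    have "(\<Phi> \<longlongrightarrow> \<Phi> x) (at_left x)" using \<Phi> by (simp add: caglad_def continuous_within)
    then have "\<forall>\<^sub>F y in at_left x. dist (\<Phi> y) (\<Phi> x) < e / 2" using e by (intro tendstoD) auto
    then obtain q where q: "q < x" "\<And>y. q < y \<Longrightarrow> y < x \<Longrightarrow> \<bar>\<Phi> y - \<Phi> x\<bar> < e / 2"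
      unfolding eventually_at_left_field dist_real_def by auto
    have ev2: "\<forall>\<^sub>F y in at_left x. max a q < y \<and> y < x"
      unfolding eventually_at_left_field using q x by (intro exI[of _ "max a q"]) auto
    show "\<forall>\<^sub>F y in at_left x. \<bar>\<psi> x - \<psi> y\<bar> \<le> e * (W x - W y)"
      using ev1 ev2
    proof eventually_elim
      case (elim y)
      then have y: "a \<le> y" "y < x" "q < y" by auto
      have Wp: "0 < W x - W y" using W(1) y by (simp add: strict_mono_def)
      have "(\<phi> y - \<phi> x) / (W y - W x) = (\<phi> x - \<phi> y) / (W x - W y)"
        by (metis minus_diff_eq minus_divide_divide)
      then have "\<bar>(\<phi> x - \<phi> y) / (W x - W y) - \<Phi> x\<bar> * (W x - W y) \<le> e / 2 * (W x - W y)"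
        using elim(1) Wp by (intro mult_right_mono) (auto simp: dist_real_def)
      also have "\<bar>(\<phi> x - \<phi> y) / (W x - W y) - \<Phi> x\<bar> * (W x - W y) = \<bar>\<phi> x - \<phi> y - \<Phi> x * (W x - W y)\<bar>"
      proof -
        have "\<phi> x - \<phi> y - \<Phi> x * (W x - W y) = ((\<phi> x - \<phi> y) / (W x - W y) - \<Phi> x) * (W x - W y)"
        proof -
          have "(\<phi> x - \<phi> y) / (W x - W y) * (W x - W y) = \<phi> x - \<phi> y" using Wp by simp
          then show ?thesis by (simp only: left_diff_distrib[of "(\<phi> x - \<phi> y) / (W x - W y)"])
        qed
        then show ?thesis using Wp by (simp add: abs_mult)
      qed
      finally have 1: "\<bar>\<phi> x - \<phi> y - \<Phi> x * (W x - W y)\<bar> \<le> e / 2 * (W x - W y)" .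
      have "\<bar>\<Phi> z - \<Phi> x\<bar> \<le> e / 2" if "z \<in> {y<..x}" for z
        using q(2)[of z] y that e by (cases "z = x") auto
      then have 2: "\<bar>I y x - \<Phi> x * (W x - W y)\<bar> \<le> e / 2 * (W x - W y)"
        using y x by (intro I_near) auto
      have "\<psi> x - \<psi> y = (\<phi> x - \<phi> y) - I y x"
        using I_add[of y x] y x by (simp add: \<psi>_def)
      then have "\<bar>\<psi> x - \<psi> y\<bar> \<le> e / 2 * (W x - W y) + e / 2 * (W x - W y)" using 1 2 by linarith
      then show ?case by simp
    qed
  qed
  moreover have "I a a = 0" by (simp add: I_def set_lebesgue_integral_def)
  ultimately show ?thesis by (simp add: \<psi>_def I_def)
qed

section \<open>One-sided regularity and classical functions\<close>

lemma cadlag_reflect: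
  assumes "cadlag f" shows "caglad (\<lambda>x. f (- x))"
  unfolding caglad_def continuous_within
proof (intro allI conjI)
  fix x
  show "((\<lambda>x. f (- x)) \<longlongrightarrow> f (- x)) (at_left x)"
    using assms unfolding filterlim_at_left_to_right by (simp add: cadlag_def continuous_within)
  obtain l where "(f \<longlongrightarrow> l) (at_left (- x))" using assms by (auto simp: cadlag_def)
  then have "((\<lambda>x. f (- x)) \<longlongrightarrow> l) (at_right x)" unfolding filterlim_at_left_to_right by simp
  then show "\<exists>l. ((\<lambda>x. f (- x)) \<longlongrightarrow> l) (at_right x)" by blast
qed

lemma caglad_reflect:
  assumes "caglad f" shows "cadlag (\<lambda>x. f (- x))"
  unfolding cadlag_def continuous_within
proof (intro allI conjI)
  fix x
  have "(f \<longlongrightarrow> f (- x)) (at_left (- x))" using assms by (simp add: caglad_def continuous_within)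
  then show "((\<lambda>x. f (- x)) \<longlongrightarrow> f (- x)) (at_right x)" unfolding filterlim_at_left_to_right by simp
  obtain l where "(f \<longlongrightarrow> l) (at_right (- x))" using assms by (auto simp: caglad_def)
  then have "((\<lambda>x. f (- x)) \<longlongrightarrow> l) (at_left x)" unfolding filterlim_at_left_to_right by simp
  then show "\<exists>l. ((\<lambda>x. f (- x)) \<longlongrightarrow> l) (at_left x)" by blast
qed

lemma tendsto_comb:
  fixes f g :: "'a \<Rightarrow> real"
  shows "(f \<longlongrightarrow> a) F \<Longrightarrow> (g \<longlongrightarrow> b) F \<Longrightarrow> ((\<lambda>x. f x + t * g x) \<longlongrightarrow> a + t * b) F"
  by (intro tendsto_intros)

lemma cadlag_comb: "cadlag f \<Longrightarrow> cadlag g \<Longrightarrow> cadlag (\<lambda>x. f x + t * g x)"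
  unfolding cadlag_def continuous_within by (fastforce intro: tendsto_comb)

lemma caglad_comb: "caglad f \<Longrightarrow> caglad g \<Longrightarrow> caglad (\<lambda>x. f x + t * g x)"
  unfolding caglad_def continuous_within by (fastforce intro: tendsto_comb)

lemma cadlag_const: "cadlag (\<lambda>x. c)" and caglad_const: "caglad (\<lambda>x. c)"
  by (auto simp: cadlag_def caglad_def)

lemma cadlag_borel_measurable: "cadlag f \<Longrightarrow> f \<in> borel_measurable borel"
  using measurable_compose[OF borel_measurable_uminus[OF measurable_ident] caglad_borel_measurable[OF cadlag_reflect]]
  by simp

lemma cadlag_bounded:
  assumes f: "cadlag f" and ab: "a \<le> b"
  shows "\<exists>K. \<forall>x\<in>{a..b}. \<bar>f x\<bar> \<le> K"
proof -
  obtain K where K: "\<forall>x\<in>{-b..-a}. \<bar>f (- x)\<bar> \<le> K"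
    using caglad_bounded[OF cadlag_reflect[OF f], of "-b" "-a"] ab by auto
  have "\<bar>f x\<bar> \<le> K" if "x \<in> {a..b}" for x using K[rule_format, of "- x"] that by simp
  then show ?thesis by blast
qed

lemma has_left_DW_unique: "has_left_DW W f x l \<Longrightarrow> has_left_DW W f x l' \<Longrightarrow> l = l'"
  unfolding has_left_DW_def by (rule tendsto_unique[OF trivial_limit_at_left_real])

lemma has_right_DV_unique: "has_right_DV V f x l \<Longrightarrow> has_right_DV V f x l' \<Longrightarrow> l = l'"
  unfolding has_right_DV_def by (rule tendsto_unique[OF trivial_limit_at_right_real])

lemma DW_eqI: "has_left_DW W f x l \<Longrightarrow> DW W f x = l"
  unfolding DW_def using has_left_DW_unique by blast

lemma DV_eqI: "has_right_DV V f x l \<Longrightarrow> DV V f x = l"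
  unfolding DV_def using has_right_DV_unique by blast

lemma has_left_DW_comb:
  assumes "has_left_DW W f x l" "has_left_DW W g x m"
  shows "has_left_DW W (\<lambda>x. f x + t * g x) x (l + t * m)"
proof -
  have "((f (x + h) + t * g (x + h)) - (f x + t * g x)) / (W (x + h) - W x)
    = (f (x + h) - f x) / (W (x + h) - W x) + t * ((g (x + h) - g x) / (W (x + h) - W x))" for h
    by (simp add: add_divide_distrib[symmetric] algebra_simps)
  then show ?thesis using assms unfolding has_left_DW_def by (simp only: tendsto_comb)
qed

lemma has_right_DV_comb:
  assumes "has_right_DV V f x l" "has_right_DV V g x m"
  shows "has_right_DV V (\<lambda>x. f x + t * g x) x (l + t * m)"
proof -
  have "((f (x + h) + t * g (x + h)) - (f x + t * g x)) / (V (x + h) - V x)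
    = (f (x + h) - f x) / (V (x + h) - V x) + t * ((g (x + h) - g x) / (V (x + h) - V x))" for h
    by (simp add: add_divide_distrib[symmetric] algebra_simps)
  then show ?thesis using assms unfolding has_right_DV_def by (simp only: tendsto_comb)
qed

lemma frakD_has_left_DW:
  assumes "\<phi> \<in> frakD W V" shows "has_left_DW W \<phi> x (DW W \<phi> x)"
proof -
  obtain l where "has_left_DW W \<phi> x l" using assms by (auto simp: frakD_def)
  then show ?thesis using DW_eqI by metis
qed

lemma frakD_has_right_DV:
  assumes "\<phi> \<in> frakD W V" shows "has_right_DV V (DW W \<phi>) x (DV V (DW W \<phi>) x)"
proof -
  obtain l where "has_right_DV V (DW W \<phi>) x l" using assms by (auto simp: frakD_def)
  then show ?thesis using DV_eqI by metis
qed

lemma DW_comb: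
  assumes "\<phi> \<in> frakD W V" "\<psi> \<in> frakD W V"
  shows "DW W (\<lambda>x. \<phi> x + t * \<psi> x) = (\<lambda>x. DW W \<phi> x + t * DW W \<psi> x)"
  using DW_eqI[OF has_left_DW_comb[OF frakD_has_left_DW[OF assms(1)] frakD_has_left_DW[OF assms(2)]]]
  by blast

lemma DV_DW_comb:
  assumes "\<phi> \<in> frakD W V" "\<psi> \<in> frakD W V"
  shows "DV V (\<lambda>x. DW W \<phi> x + t * DW W \<psi> x) = (\<lambda>x. DV V (DW W \<phi>) x + t * DV V (DW W \<psi>) x)"
  using DV_eqI[OF has_right_DV_comb[OF frakD_has_right_DV[OF assms(1)] frakD_has_right_DV[OF assms(2)]]]
  by blast

lemma frakD_comb:
  assumes \<phi>: "\<phi> \<in> frakD W V" and \<psi>: "\<psi> \<in> frakD W V"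
  shows "(\<lambda>x. \<phi> x + t * \<psi> x) \<in> frakD W V"
  unfolding frakD_def mem_Collect_eq DW_comb[OF assms] DV_DW_comb[OF assms]
proof (intro conjI allI)
  show "one_periodic (\<lambda>x. \<phi> x + t * \<psi> x)"
    using assms by (auto simp: frakD_def one_periodic_def)
  show "cadlag (\<lambda>x. \<phi> x + t * \<psi> x)" using assms by (auto simp: frakD_def intro: cadlag_comb)
  show "\<exists>l. has_left_DW W (\<lambda>x. \<phi> x + t * \<psi> x) x l" for x
    using has_left_DW_comb[OF frakD_has_left_DW[OF \<phi>] frakD_has_left_DW[OF \<psi>]] by blast
  show "caglad (\<lambda>x. DW W \<phi> x + t * DW W \<psi> x)" using assms by (auto simp: frakD_def intro: caglad_comb)
  show "\<exists>l. has_right_DV V (\<lambda>x. DW W \<phi> x + t * DW W \<psi> x) x l" for x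
    using has_right_DV_comb[OF frakD_has_right_DV[OF \<phi>] frakD_has_right_DV[OF \<psi>]] by blast
  show "cadlag (\<lambda>x. DV V (DW W \<phi>) x + t * DV V (DW W \<psi>) x)"
    using assms by (auto simp: frakD_def intro: cadlag_comb)
qed

lemma DW_const: "DW W (\<lambda>x. c) = (\<lambda>x. 0)"
  by (rule ext, rule DW_eqI) (simp add: has_left_DW_def)

lemma frakD_const: "(\<lambda>x. c) \<in> frakD W V"
proof -
  have "DV V (\<lambda>x. 0) = (\<lambda>x. 0)"
    by (rule ext, rule DV_eqI) (simp add: has_right_DV_def)
  moreover have "\<exists>l. has_left_DW W (\<lambda>x. c) x l" "\<exists>l. has_right_DV V (\<lambda>x. 0) x l" for x
    by (auto simp: has_left_DW_def has_right_DV_def intro!: exI[of _ 0])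
  ultimately show ?thesis
    by (simp add: frakD_def one_periodic_def cadlag_const caglad_const DW_const)
qed

lemma frakD_diff:
  assumes "\<phi> \<in> frakD W V" "\<psi> \<in> frakD W V"
  shows "(\<lambda>x. \<phi> x - \<psi> x) \<in> frakD W V"
    and "DW W (\<lambda>x. \<phi> x - \<psi> x) = (\<lambda>x. DW W \<phi> x - DW W \<psi> x)"
  using frakD_comb[OF assms, of "-1"] DW_comb[OF assms, of "-1"] by simp_all

lemma one_periodic_DW:
  assumes W: "\<And>x. W (x + 1) - W x = W 1 - W 0" and \<phi>: "one_periodic \<phi>"
  shows "one_periodic (DW W \<phi>)"
proof -
  have "has_left_DW W \<phi> (x + 1) = has_left_DW W \<phi> x" for x
  proof -
    have "W (x + 1 + h) - W (x + 1) = W (x + h) - W x" for h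
      using W[of "x + h"] W[of x] by (simp add: add.commute add.left_commute)
    moreover have "\<phi> (x + 1 + h) = \<phi> (x + h)" "\<phi> (x + 1) = \<phi> x" for h
      using \<phi> unfolding one_periodic_def by (metis add.assoc add.commute)+
    ultimately show ?thesis by (simp add: has_left_DW_def fun_eq_iff)
  qed
  then show ?thesis by (simp add: one_periodic_def DW_def)
qed

section \<open>The measures on the torus\<close>

lemma nonneg_eq_0_of_le_tendsto_0:
  fixes a :: ennreal
  assumes "\<forall>\<^sub>F h in F. a \<le> ennreal (g h)" "(g \<longlongrightarrow> 0) F" "F \<noteq> bot"
  shows "a = 0"
proof -
  have "((\<lambda>h. ennreal (g h)) \<longlongrightarrow> ennreal 0) F" using assms(2) by (rule tendsto_ennrealI)
  then have "a \<le> ennreal 0" using assms(1,3) by (intro tendsto_lowerbound)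
  then show ?thesis by simp
qed

locale torus_pair =
  fixes W V :: "real \<Rightarrow> real"
  assumes W_strict: "strict_mono W" and W_cadlag: "cadlag W"
    and W_shift: "\<And>x. W (x + 1) - W x = W 1 - W 0" and W_cont: "isCont W 0"
    and V_strict: "strict_mono V" and V_caglad: "caglad V"
begin

abbreviation "\<mu> \<equiv> dW W"
abbreviation "\<nu> \<equiv> dV V"
abbreviation "\<D> \<equiv> frakD W V"

lemma W_rc: "continuous (at_right x) W"
  using W_cadlag by (simp add: cadlag_def)

lemma W_mono: "mono W"
  using W_strict by (rule strict_mono_mono)

lemma emeasure_W_Ioc: "a \<le> b \<Longrightarrow> emeasure (interval_measure W) {a<..b} = ennreal (W b - W a)"
  using W_mono by (intro emeasure_interval_measure_Ioc W_rc) (auto simp: mono_def)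

lemma emeasure_W_atom: assumes "isCont W a" shows "emeasure (interval_measure W) {a} = 0"
proof (rule nonneg_eq_0_of_le_tendsto_0)
  have "(W \<longlongrightarrow> W a) (at_left a)" using assms by (simp add: isCont_def filterlim_at_split)
  then have "((\<lambda>y. W a - W y) \<longlongrightarrow> W a - W a) (at_left a)" by (intro tendsto_intros)
  then show "((\<lambda>y. W a - W y) \<longlongrightarrow> 0) (at_left a)" by simp
  have "emeasure (interval_measure W) {a} \<le> ennreal (W a - W y)" if "y < a" for y
    using that by (subst emeasure_W_Ioc[symmetric]) (auto intro!: emeasure_mono)
  then show "\<forall>\<^sub>F y in at_left a. emeasure (interval_measure W) {a} \<le> ennreal (W a - W y)"
    unfolding eventually_at_left_field by (intro exI[of _ "a - 1"]) auto
qed simp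

lemma W_cont_1: "isCont W 1"
proof -
  have "W = (\<lambda>x. W (x - 1) + (W 1 - W 0))" using W_shift[of "x - 1" for x] by (simp add: fun_eq_iff algebra_simps)
  moreover have "isCont (\<lambda>x. W (x - 1) + (W 1 - W 0)) 1"
    using W_cont by (intro continuous_intros isCont_o2[of _ "\<lambda>x. x - 1" W]) simp_all
  ultimately show ?thesis by simp
qed

lemma space_\<mu>: "space \<mu> = {0..<1}" and space_\<nu>: "space \<nu> = {0..<1}"
  by (simp_all add: dW_def dV_def space_restrict_space)

lemma sets_\<mu>: "sets \<mu> = sets (restrict_space borel {0..<1})"
  and sets_\<nu>: "sets \<nu> = sets (restrict_space borel {0..<1})"
  unfolding dW_def dV_def by (rule restrict_space_sets_cong; simp)+

lemma borel_measurable_\<mu>: "f \<in> borel_measurable borel \<Longrightarrow> f \<in> borel_measurable \<mu>"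
  and borel_measurable_\<nu>: "f \<in> borel_measurable borel \<Longrightarrow> f \<in> borel_measurable \<nu>"
  by (simp_all add: measurable_restrict_space1 measurable_cong_sets[OF sets_\<mu>] measurable_cong_sets[OF sets_\<nu>])

lemma sets_\<mu>I: "A \<in> sets borel \<Longrightarrow> A \<subseteq> {0..<1} \<Longrightarrow> A \<in> sets \<mu>"
  and sets_\<nu>I: "A \<in> sets borel \<Longrightarrow> A \<subseteq> {0..<1} \<Longrightarrow> A \<in> sets \<nu>"
  unfolding sets_\<mu> sets_\<nu> by (simp_all add: sets_restrict_space_iff)

lemma finite_\<mu>: "finite_measure \<mu>"
proof (rule finite_measureI)
  have "emeasure \<mu> (space \<mu>) = emeasure (interval_measure W) {0..<1}"
    unfolding space_\<mu> unfolding dW_def by (rule emeasure_restrict_space) auto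
  also have "\<dots> \<le> emeasure (interval_measure W) {-1<..1}" by (rule emeasure_mono) auto
  also have "\<dots> = ennreal (W 1 - W (-1))" by (simp add: emeasure_W_Ioc)
  finally show "emeasure \<mu> (space \<mu>) \<noteq> \<infinity>" by (auto simp: top_unique)
qed

lemma emeasure_\<nu>_Ico: "0 \<le> a \<Longrightarrow> a \<le> b \<Longrightarrow> b \<le> 1 \<Longrightarrow> emeasure \<nu> {a..<b} = ennreal (V b - V a)"
  by (rule emeasure_dV_Ico[OF V_strict V_caglad])

lemma finite_\<nu>: "finite_measure \<nu>"
  by (rule finite_measureI) (simp add: space_\<nu> emeasure_\<nu>_Ico)

sublocale \<mu>: finite_measure \<mu> by (rule finite_\<mu>)
sublocale \<nu>: finite_measure \<nu> by (rule finite_\<nu>)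

lemma \<nu>_space_pos: "0 < measure \<nu> (space \<nu>)"
proof -
  have "0 < V 1 - V 0" using V_strict by (simp add: strict_mono_def)
  then show ?thesis by (simp add: measure_def space_\<nu> emeasure_\<nu>_Ico)
qed

text \<open>
  Continuity of \<open>W\<close> at \<open>0\<close> makes the base point of the torus a null set, which reconciles integrals over
  \<open>[0,1)\<close> with integrals over \<open>(0,1]\<close>.
\<close>

lemma \<mu>_AE_pos: "AE y in \<mu>. 0 < y"
proof -
  have "emeasure \<mu> {0} = emeasure (interval_measure W) {0}"
    unfolding dW_def by (rule emeasure_restrict_space) auto
  then have "{0} \<in> null_sets \<mu>"
    using emeasure_W_atom[OF W_cont] by (intro null_setsI sets_\<mu>I) auto
  then have "AE y in \<mu>. y \<notin> {0}" by (rule AE_not_in)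
  then show ?thesis using AE_space by eventually_elim (auto simp: space_\<mu>)
qed

lemma \<mu>_set_integral:
  fixes F :: "real \<Rightarrow> real"
  assumes "0 \<le> a" "b < 1"
  shows "(LINT y:{a<..b}|\<mu>. F y) = (LINT y:{a<..b}|interval_measure W. F y)"
proof -
  have "(LINT y:{a<..b}|\<mu>. F y) = (LINT y:{a<..b}|interval_measure W. indicator {0..<1} y *\<^sub>R F y)"
    unfolding dW_def by (rule set_integral_restrict_space) simp
  also have "\<dots> = (LINT y:{a<..b}|interval_measure W. F y)"
    unfolding set_lebesgue_integral_def
    by (intro Bochner_Integration.integral_cong) (use assms in \<open>auto simp: indicator_def\<close>)
  finally show ?thesis .
qed

lemma \<mu>_integral:
  fixes F :: "real \<Rightarrow> real"
  assumes F: "F \<in> borel_measurable borel"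
  shows "(LINT y|\<mu>. F y) = (LINT y:{0<..1}|interval_measure W. F y)"
proof -
  let ?M = "interval_measure W"
  have "{0} \<in> null_sets ?M" "{1} \<in> null_sets ?M"
    using emeasure_W_atom[OF W_cont] emeasure_W_atom[OF W_cont_1] by (auto intro!: null_setsI)
  then have "AE y in ?M. y \<notin> {0}" "AE y in ?M. y \<notin> {1}" by (auto dest!: AE_not_in)
  then have ae: "AE y in ?M. indicator {0..<1} y *\<^sub>R F y = indicator {0<..1} y *\<^sub>R F y"
    by eventually_elim (auto simp: indicator_def)
  have "(LINT y|\<mu>. F y) = (LINT y|?M. indicator {0..<1} y *\<^sub>R F y)"
    unfolding dW_def by (rule integral_restrict_space) simp
  also have "\<dots> = (LINT y|?M. indicator {0<..1} y *\<^sub>R F y)"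
    by (rule integral_cong_AE) (use F ae in auto)
  finally show ?thesis by (simp add: set_lebesgue_integral_def)
qed

context
  fixes \<phi> assumes \<phi>: "\<phi> \<in> \<D>"
begin

lemma frakD_periodic: "one_periodic \<phi>" and frakD_DW_periodic: "one_periodic (DW W \<phi>)"
  and frakD_cadlag: "cadlag \<phi>" and frakD_DW_caglad: "caglad (DW W \<phi>)"
  and frakD_DV_cadlag: "cadlag (DV V (DW W \<phi>))"
  using \<phi> one_periodic_DW[of W \<phi>, OF W_shift] by (auto simp: frakD_def)

lemma frakD_FTC: "0 \<le> a \<Longrightarrow> a \<le> b \<Longrightarrow>
    (LINT y:{a<..b}|interval_measure W. DW W \<phi> y) = \<phi> b - \<phi> a"
  using frakD_cadlag by (intro left_derivative_FTC[OF W_strict W_rc _ frakD_has_left_DW[OF \<phi>] frakD_DW_caglad])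
    (auto simp: cadlag_def)

lemma frakD_eq_integral:
  assumes "x \<in> {0..<1}" shows "\<phi> x = \<phi> 0 + (LINT y:{0<..x}|\<mu>. DW W \<phi> y)"
  using frakD_FTC[of 0 x] assms by (simp add: \<mu>_set_integral)

lemma frakD_integral_DW: "(LINT y|\<mu>. DW W \<phi> y) = 0"
proof -
  have "\<phi> 1 = \<phi> 0" using frakD_periodic by (metis add_0 one_periodic_def)
  then show ?thesis
    using frakD_FTC[of 0 1] \<mu>_integral[OF caglad_borel_measurable[OF frakD_DW_caglad]] by simp
qed

text \<open>
  Reflection \<open>x \<mapsto> - x\<close> exchanges left and right, so this is \<open>left_derivative_FTC\<close> for the reflected
  functions and the measure from which \<open>dV\<close> is defined.
\<close>

lemma frakD_FTC_DV:
  assumes ab: "0 \<le> a" "a \<le> b" "b \<le> 1"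
  shows "(LINT x:{a..<b}|\<nu>. DV V (DW W \<phi>) x) = DW W \<phi> b - DW W \<phi> a"
proof -
  define U where "U = (\<lambda>x. - V (- x))"
  define \<Phi> where "\<Phi> = DW W \<phi>"
  define g where "g = DV V \<Phi>"
  have "cadlag (\<lambda>x. V (- x))" by (rule caglad_reflect[OF V_caglad])
  from cadlag_comb[OF cadlag_const[of 0] this, of "-1"]
  have U_rc: "continuous (at_right x) U" for x by (simp add: cadlag_def U_def)
  have U_strict: "strict_mono U" using V_strict by (simp add: U_def strict_mono_def)
  have \<Phi>_rc: "continuous (at_right x) (\<lambda>x. \<Phi> (- x))" for x
    using caglad_reflect[OF frakD_DW_caglad] by (simp add: cadlag_def \<Phi>_def)
  have g_cadlag: "cadlag g" using frakD_DV_cadlag by (simp add: g_def \<Phi>_def)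
  have "caglad (\<lambda>x. g (- x))" by (rule cadlag_reflect[OF g_cadlag])
  from caglad_comb[OF caglad_const[of 0] this, of "-1"] have g_caglad: "caglad (\<lambda>x. - g (- x))" by simp
  have deriv: "has_left_DW U (\<lambda>x. \<Phi> (- x)) x (- g (- x))" for x
  proof -
    have "((\<lambda>h. (\<Phi> (- x + h) - \<Phi> (- x)) / (V (- x + h) - V (- x))) \<longlongrightarrow> g (- x)) (at_right 0)"
      using frakD_has_right_DV[OF \<phi>, of "- x"] by (simp add: has_right_DV_def \<Phi>_def g_def)
    then have "((\<lambda>h. (\<Phi> (- x + - h) - \<Phi> (- x)) / (V (- x + - h) - V (- x))) \<longlongrightarrow> g (- x)) (at_left 0)"
      unfolding filterlim_at_left_to_right by simp
    then have "((\<lambda>h. - ((\<Phi> (- x + - h) - \<Phi> (- x)) / (V (- x + - h) - V (- x)))) \<longlongrightarrow> - g (- x)) (at_left 0)"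
      by (rule tendsto_minus)
    moreover have "- ((\<Phi> (- x + - h) - \<Phi> (- x)) / (V (- x + - h) - V (- x)))
      = (\<Phi> (- (x + h)) - \<Phi> (- x)) / (U (x + h) - U x)" for h
      by (simp add: U_def) (metis (no_types, opaque_lifting) minus_diff_eq minus_divide_right)
    ultimately show ?thesis by (simp add: has_left_DW_def)
  qed
  have eq: "indicator {a..<b} (- x) * (indicator {0..<1} (- x) * g (- x)) = - (indicator {- b<..- a} x * - g (- x))" for x
    using ab by (auto simp: indicator_def)
  have "(LINT x:{a..<b}|\<nu>. g x) = (LINT x|distr (interval_measure U) borel uminus. indicator {a..<b} x * (indicator {0..<1} x * g x))"
    unfolding dV_def U_def[symmetric]
    by (subst set_integral_restrict_space) (auto simp: set_lebesgue_integral_def)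
  also have "\<dots> = (LINT x|interval_measure U. indicator {a..<b} (- x) * (indicator {0..<1} (- x) * g (- x)))"
    using cadlag_borel_measurable[OF g_cadlag] by (intro integral_distr) auto
  also have "\<dots> = - (LINT x:{- b<..- a}|interval_measure U. - g (- x))"
    unfolding eq set_lebesgue_integral_def by simp
  also have "(LINT x:{- b<..- a}|interval_measure U. - g (- x)) = \<Phi> (- (- a)) - \<Phi> (- (- b))"
    using ab by (intro left_derivative_FTC[OF U_strict U_rc \<Phi>_rc deriv g_caglad]) auto
  finally show ?thesis by (simp add: \<Phi>_def g_def)
qed

lemma frakD_square_integrable: "square_integrable \<nu> \<phi>"
proof -
  obtain K where "\<forall>x\<in>{0..1}. \<bar>\<phi> x\<bar> \<le> K" using cadlag_bounded[OF frakD_cadlag, of 0 1] by auto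
  then show ?thesis
    by (intro \<nu>.square_integrable_bounded[of _ K] borel_measurable_\<nu> cadlag_borel_measurable frakD_cadlag)
      (auto simp: space_\<nu>)
qed

lemma frakD_DW_square_integrable: "square_integrable \<mu> (DW W \<phi>)"
proof -
  obtain K where "\<forall>x\<in>{0..1}. \<bar>DW W \<phi> x\<bar> \<le> K" using caglad_bounded[OF frakD_DW_caglad, of 0 1] by auto
  then show ?thesis
    by (intro \<mu>.square_integrable_bounded[of _ K] borel_measurable_\<mu> caglad_borel_measurable frakD_DW_caglad)
      (auto simp: space_\<mu>)
qed

end

end

section \<open>The energy of a classical function\<close>

context torus_pair
begin

text \<open>
  Integration by parts, in the form of Fubini's theorem on the triangle \<open>0 < y \<le> x\<close>: writing
  \<open>\<phi> x = \<phi> 0 + \<integral>\<^bsub>(0,x]\<^esub> \<Phi> dW\<close> and integrating \<open>g = D\<Phi>\<close> over \<open>[y,1)\<close> first gives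
  \<open>\<integral> g \<phi> dV = \<integral> \<Phi> y (\<Phi> 1 - \<Phi> y) dW = - \<integral> \<Phi>\<^sup>2 dW\<close>. Boundary terms cancel because \<open>\<phi>\<close> and \<open>\<Phi>\<close>
  are periodic. The half-open intervals of the two measures fit together, so common jumps of \<open>W\<close> and \<open>V\<close>
  leave no extra term.
\<close>

lemma frakD_energy:
  assumes \<phi>: "\<phi> \<in> \<D>"
  shows "L2_inner \<nu> (\<lambda>x. \<phi> x - DV V (DW W \<phi>) x) \<phi>
    = (LINT x|\<nu>. (\<phi> x)\<^sup>2) + (LINT y|\<mu>. (DW W \<phi> y)\<^sup>2)"
proof -
  define \<Phi> where "\<Phi> = DW W \<phi>"
  define g where "g = DV V \<Phi>"
  have g_cadlag: "cadlag g" using frakD_DV_cadlag[OF \<phi>] by (simp add: g_def \<Phi>_def)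
  have \<Phi>_caglad: "caglad \<Phi>" using frakD_DW_caglad[OF \<phi>] by (simp add: \<Phi>_def)
  obtain Kg where Kg: "\<forall>x\<in>{0..1}. \<bar>g x\<bar> \<le> Kg" using cadlag_bounded[OF g_cadlag, of 0 1] by auto
  obtain K\<Phi> where K\<Phi>: "\<forall>x\<in>{0..1}. \<bar>\<Phi> x\<bar> \<le> K\<Phi>" using caglad_bounded[OF \<Phi>_caglad, of 0 1] by auto
  have gm [measurable]: "g \<in> borel_measurable \<nu>" by (intro borel_measurable_\<nu> cadlag_borel_measurable g_cadlag)
  have \<Phi>m [measurable]: "\<Phi> \<in> borel_measurable \<mu>" by (intro borel_measurable_\<mu> caglad_borel_measurable \<Phi>_caglad)
  have idm [measurable]: "(\<lambda>x. x) \<in> borel_measurable \<mu>" "(\<lambda>x. x) \<in> borel_measurable \<nu>"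
    by (auto intro: borel_measurable_\<mu> borel_measurable_\<nu>)
  have g_sq: "square_integrable \<nu> g"
    by (rule \<nu>.square_integrable_bounded[OF gm, of Kg]) (use Kg in \<open>auto simp: space_\<nu>\<close>)
  have \<Phi>_sq: "square_integrable \<mu> \<Phi>" using frakD_DW_square_integrable[OF \<phi>] by (simp add: \<Phi>_def)
  have \<phi>_sq: "square_integrable \<nu> \<phi>" by (rule frakD_square_integrable[OF \<phi>])
  note g_int = \<nu>.square_integrable_integrable[OF g_sq] and g\<phi>_int = square_integrable_mult[OF g_sq \<phi>_sq]
    and \<Phi>_int = \<mu>.square_integrable_integrable[OF \<Phi>_sq]
  have FTC_g: "(LINT x:{a..<1}|\<nu>. g x) = \<Phi> 1 - \<Phi> a" if "0 \<le> a" "a \<le> 1" for a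
    unfolding g_def \<Phi>_def using that by (intro frakD_FTC_DV[OF \<phi>]) auto
  define k where "k x y = (if 0 < y \<and> y \<le> x then g x * \<Phi> y else 0)" for x y
  interpret pair: pair_sigma_finite \<nu> \<mu> ..
  interpret prod: finite_measure "\<nu> \<Otimes>\<^sub>M \<mu>"
    by (rule finite_measure_pair_measure[OF finite_\<mu> finite_\<nu>])
  have "case_prod k \<in> borel_measurable (\<nu> \<Otimes>\<^sub>M \<mu>)" unfolding k_def by measurable
  moreover have "\<bar>k x y\<bar> \<le> \<bar>Kg\<bar> * \<bar>K\<Phi>\<bar>" if "x \<in> {0..<1}" "y \<in> {0..<1}" for x y
  proof -
    have "\<bar>g x\<bar> \<le> \<bar>Kg\<bar>" "\<bar>\<Phi> y\<bar> \<le> \<bar>K\<Phi>\<bar>" using Kg K\<Phi> that by (auto intro: order_trans[OF _ abs_ge_self])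
    then show ?thesis by (auto simp: k_def abs_mult intro!: mult_mono)
  qed
  ultimately have k_int: "integrable (\<nu> \<Otimes>\<^sub>M \<mu>) (case_prod k)"
    by (intro prod.integrable_const_bound[of _ "\<bar>Kg\<bar> * \<bar>K\<Phi>\<bar>"] AE_I2) (auto simp: space_pair_measure space_\<mu> space_\<nu>)
  have inner_y: "(LINT y|\<mu>. k x y) = g x * \<phi> x - \<phi> 0 * g x" if "x \<in> space \<nu>" for x
  proof -
    have "(LINT y|\<mu>. k x y) = (LINT y|\<mu>. g x * (indicator {0<..x} y * \<Phi> y))"
      by (intro Bochner_Integration.integral_cong) (auto simp: k_def indicator_def)
    also have "\<dots> = g x * (LINT y:{0<..x}|\<mu>. \<Phi> y)"
      by (simp add: set_lebesgue_integral_def)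
    also have "(LINT y:{0<..x}|\<mu>. \<Phi> y) = \<phi> x - \<phi> 0"
      using frakD_eq_integral[OF \<phi>, of x] that by (simp add: space_\<nu> \<Phi>_def)
    finally show ?thesis by (simp add: algebra_simps)
  qed
  have inner_x: "AE y in \<mu>. (LINT x|\<nu>. k x y) = \<Phi> 1 * \<Phi> y - (\<Phi> y)\<^sup>2"
    using \<mu>_AE_pos AE_space
  proof eventually_elim
    case (elim y)
    have "(LINT x|\<nu>. k x y) = (LINT x|\<nu>. \<Phi> y * (indicator {y..<1} x * g x))"
      by (intro Bochner_Integration.integral_cong) (use elim in \<open>auto simp: k_def indicator_def space_\<nu>\<close>)
    also have "\<dots> = \<Phi> y * (LINT x:{y..<1}|\<nu>. g x)"
      by (simp add: set_lebesgue_integral_def)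
    also have "\<dots> = \<Phi> y * (\<Phi> 1 - \<Phi> y)" using elim by (simp add: FTC_g space_\<mu>)
    finally show ?case by (simp add: power2_eq_square algebra_simps)
  qed
  have "(LINT x|\<nu>. g x) = (LINT x:{0..<1}|\<nu>. g x)"
    unfolding set_lebesgue_integral_def
    by (intro Bochner_Integration.integral_cong) (auto simp: space_\<nu> indicator_def)
  also have "\<dots> = 0"
    using FTC_g[of 0] frakD_DW_periodic[OF \<phi>] by (metis \<Phi>_def add_0 diff_self one_periodic_def order_refl zero_le_one)
  finally have g_mean: "(LINT x|\<nu>. g x) = 0" .
  have "(LINT x|\<nu>. g x * \<phi> x) = (LINT x|\<nu>. g x * \<phi> x - \<phi> 0 * g x)"
    using g_mean g\<phi>_int g_int by simp
  also have "\<dots> = (LINT x|\<nu>. (LINT y|\<mu>. k x y))"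
    by (intro Bochner_Integration.integral_cong) (simp_all add: inner_y)
  also have "\<dots> = (LINT y|\<mu>. (LINT x|\<nu>. k x y))"
    using pair.Fubini_integral[OF k_int] by simp
  also have "\<dots> = (LINT y|\<mu>. \<Phi> 1 * \<Phi> y - (\<Phi> y)\<^sup>2)"
  proof (rule integral_cong_AE[OF _ _ inner_x])
    show "(\<lambda>y. LINT x|\<nu>. k x y) \<in> borel_measurable \<mu>" unfolding k_def by measurable
  qed measurable
  also have "\<dots> = - (LINT y|\<mu>. (\<Phi> y)\<^sup>2)"
    using frakD_integral_DW[OF \<phi>] \<Phi>_int square_integrable_square[OF \<Phi>_sq] by (simp add: \<Phi>_def)
  finally have parts: "(LINT x|\<nu>. g x * \<phi> x) = - (LINT y|\<mu>. (\<Phi> y)\<^sup>2)" .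
  have "L2_inner \<nu> (\<lambda>x. \<phi> x - g x) \<phi> = (LINT x|\<nu>. (\<phi> x)\<^sup>2 - g x * \<phi> x)"
    unfolding L2_inner_def by (intro Bochner_Integration.integral_cong) (auto simp: power2_eq_square algebra_simps)
  also have "\<dots> = (LINT x|\<nu>. (\<phi> x)\<^sup>2) + (LINT y|\<mu>. (\<Phi> y)\<^sup>2)"
    using parts square_integrable_square[OF \<phi>_sq] g\<phi>_int by simp
  finally show ?thesis by (simp add: g_def \<Phi>_def)
qed

end

section \<open>Weak derivatives\<close>

text \<open>
  The rays \<open>{..x}\<close> form an intersection-stable generator of the Borel sets, so the integral of \<open>h\<close>
  vanishes over every Borel set.
\<close>

lemma AE_zero_of_integral_atMost:
  fixes h :: "real \<Rightarrow> real"
  assumes sets: "sets M = sets borel" and h: "integrable M h"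
    and atMost: "\<And>x. (LINT y:{..x}|M. h y) = 0" and total: "(LINT y|M. h y) = 0"
  shows "AE y in M. h y = 0"
proof -
  have sp: "space M = UNIV" using sets_eq_imp_space_eq[OF sets] by simp
  have sint: "set_integrable M A h" if "A \<in> sets M" for A
    using integrable_mult_indicator[OF that h] by (simp add: set_integrable_def)
  have "(LINT y:A|M. h y) = 0" if A: "A \<in> sets M" for A
  proof -
    let ?G = "range (\<lambda>x::real. {..x})"
    have B: "sets M = sigma_sets UNIV ?G"
      using sets borel_eq_atMost by (metis sets_measure_of top_greatest Pow_UNIV)
    have "Int_stable ?G" by (auto simp: Int_stable_def)
    then show ?thesis
    proof (rule sigma_sets_induct_disjoint)
      show "?G \<subseteq> Pow UNIV" by simp
      show "A \<in> sigma_sets UNIV ?G" using A B by simp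
    next
      fix A assume "A \<in> ?G"
      then show "(LINT y:A|M. h y) = 0" using atMost by auto
    next
      show "(LINT y:{}|M. h y) = 0" by (simp add: set_lebesgue_integral_def)
    next
      fix A assume "A \<in> sigma_sets UNIV ?G" and A0: "(LINT y:A|M. h y) = 0"
      then have A: "A \<in> sets M" using B by simp
      then have A': "UNIV - A \<in> sets M" using sp by (metis sets.compl_sets)
      have "(LINT y:A \<union> (UNIV - A)|M. h y) = (LINT y:A|M. h y) + (LINT y:UNIV - A|M. h y)"
        by (intro set_integral_Un sint A A') auto
      moreover have "(LINT y:A \<union> (UNIV - A)|M. h y) = 0"
        using total by (simp add: set_lebesgue_integral_def)
      ultimately show "(LINT y:UNIV - A|M. h y) = 0" using A0 by simp
    next
      fix A :: "nat \<Rightarrow> real set"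
      assume "disjoint_family A" "range A \<subseteq> sigma_sets UNIV ?G"
        and A0: "\<And>i. (LINT y:A i|M. h y) = 0"
      then have A: "\<And>i. A i \<in> sets M" and dis: "\<And>i j. i \<noteq> j \<Longrightarrow> A i \<inter> A j = {}"
        using B by (auto simp: disjoint_family_on_def)
      have "(LINT y:(\<Union>i. A i)|M. h y) = (\<Sum>i. LINT y:A i|M. h y)"
        by (rule lebesgue_integral_countable_add[OF A dis]) (use A in \<open>auto intro!: sint\<close>)
      then show "(LINT y:(\<Union>i. A i)|M. h y) = 0" using A0 by simp
    qed
  qed
  then show ?thesis
    by (intro density_unique_real[OF h, of "\<lambda>x. 0"]) auto
qed

lemma L2_tendsto_cong_AE:
  assumes "\<And>n. square_integrable M (f n)" "square_integrable M g" "square_integrable M h"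
    and "AE x in M. g x = h x" "L2_tendsto M f g"
  shows "L2_tendsto M f h"
proof -
  have "(LINT x|M. (f n x - h x)\<^sup>2) = (LINT x|M. (f n x - g x)\<^sup>2)" for n
  proof (rule integral_cong_AE)
    show "AE x in M. (f n x - h x)\<^sup>2 = (f n x - g x)\<^sup>2" using assms(4) by eventually_elim simp
  qed (use assms(1)[of n] assms(2,3) in \<open>auto simp: square_integrable_def\<close>)
  then show ?thesis using assms(5) by (simp add: L2_tendsto_def)
qed

context torus_pair
begin

definition primitive :: "(real \<Rightarrow> real) \<Rightarrow> real \<Rightarrow> real" where
  "primitive F x = (LINT y:{0<..x}|\<mu>. F y)"

lemma set_integrable_\<mu>: "integrable \<mu> F \<Longrightarrow> A \<in> sets \<mu> \<Longrightarrow> set_integrable \<mu> A (F :: real \<Rightarrow> real)"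
  unfolding set_integrable_def by (rule integrable_mult_indicator)

lemma set_integral_square_le:
  assumes F: "square_integrable \<mu> F" and A: "A \<in> sets \<mu>"
  shows "(LINT y:A|\<mu>. F y)\<^sup>2 \<le> measure \<mu> A * (LINT y|\<mu>. (F y)\<^sup>2)"
proof -
  have "square_integrable \<mu> (indicator A)"
    using A by (intro \<mu>.square_integrable_bounded[of _ 1]) (auto simp: indicator_def)
  from L2_Cauchy_Schwarz[OF this F]
  have "(LINT y|\<mu>. indicator A y * F y)\<^sup>2 \<le> (LINT y|\<mu>. (indicator A y)\<^sup>2) * (LINT y|\<mu>. (F y)\<^sup>2)" .
  moreover have "(\<lambda>y. (indicator A y :: real)\<^sup>2) = indicator A" by (auto simp: indicator_def)
  ultimately show ?thesis using A by (simp add: set_lebesgue_integral_def)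
qed

text \<open>
  By Cauchy-Schwarz the primitive is controlled uniformly, so \<open>L\<^sup>2\<close> convergence of derivatives makes
  primitives converge uniformly.
\<close>

lemma primitive_square_le:
  assumes F: "square_integrable \<mu> F" and x: "x < 1"
  shows "(primitive F x)\<^sup>2 \<le> measure \<mu> (space \<mu>) * (LINT y|\<mu>. (F y)\<^sup>2)"
proof -
  have "{0<..x} \<in> sets \<mu>" using x by (intro sets_\<mu>I) auto
  from set_integral_square_le[OF F this]
  have "(primitive F x)\<^sup>2 \<le> measure \<mu> {0<..x} * (LINT y|\<mu>. (F y)\<^sup>2)" by (simp add: primitive_def)
  also have "\<dots> \<le> measure \<mu> (space \<mu>) * (LINT y|\<mu>. (F y)\<^sup>2)"
    by (intro mult_right_mono \<mu>.bounded_measure) simp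
  finally show ?thesis .
qed

lemma primitive_diff:
  assumes "square_integrable \<mu> F" "square_integrable \<mu> G" "x < 1"
  shows "primitive (\<lambda>y. F y - G y) x = primitive F x - primitive G x"
proof -
  have "{0<..x} \<in> sets \<mu>" using assms(3) by (intro sets_\<mu>I) auto
  then show ?thesis unfolding primitive_def using assms
    by (intro set_integral_diff set_integrable_\<mu> \<mu>.square_integrable_integrable)
qed

lemma primitive_square_integrable:
  assumes F: "square_integrable \<mu> F"
  shows "square_integrable \<nu> (primitive F)"
proof (rule \<nu>.square_integrable_bounded)
  have [measurable]: "F \<in> borel_measurable \<mu>" using F by (simp add: square_integrable_def)
  have idm [measurable]: "(\<lambda>x. x) \<in> borel_measurable \<mu>" "(\<lambda>x. x) \<in> borel_measurable \<nu>"
    by (auto intro: borel_measurable_\<mu> borel_measurable_\<nu>)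
  have "primitive F = (\<lambda>x. LINT y|\<mu>. (if 0 < y \<and> y \<le> x then F y else 0))"
    unfolding primitive_def set_lebesgue_integral_def
    by (intro ext Bochner_Integration.integral_cong) (auto simp: indicator_def)
  also have "\<dots> \<in> borel_measurable \<nu>" by measurable
  finally show "primitive F \<in> borel_measurable \<nu>" .
  fix x assume "x \<in> space \<nu>"
  then have "\<bar>primitive F x\<bar>\<^sup>2 \<le> measure \<mu> (space \<mu>) * (LINT y|\<mu>. (F y)\<^sup>2)"
    using primitive_square_le[OF F, of x] by (simp add: space_\<nu>)
  then show "\<bar>primitive F x\<bar> \<le> sqrt (measure \<mu> (space \<mu>) * (LINT y|\<mu>. (F y)\<^sup>2))"
    by (rule real_le_rsqrt)
qed

lemma torus_L2_square_integrable: "f \<in> torus_L2 M \<Longrightarrow> square_integrable M f"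
  by (simp add: torus_L2_def square_integrable_def)

lemma frakD_torus_L2: "\<phi> \<in> \<D> \<Longrightarrow> \<phi> \<in> torus_L2 \<nu>"
  using frakD_square_integrable frakD_periodic by (auto simp: torus_L2_def square_integrable_def)

lemma torus_L2_representative:
  assumes f: "square_integrable M f" and sp: "space M = {0..<1}"
  obtains f' where "f' \<in> torus_L2 M" "\<And>x. x \<in> space M \<Longrightarrow> f' x = f x"
proof
  have eq: "(f \<circ> frac) x = f x" if "x \<in> space M" for x using that by (simp add: sp frac_eq)
  then show "(f \<circ> frac) x = f x" if "x \<in> space M" for x using that .
  have "one_periodic (f \<circ> frac)" by (simp add: one_periodic_def frac_1_eq)
  moreover have "(f \<circ> frac) \<in> borel_measurable M"
    using f measurable_cong[of M "f \<circ> frac" f borel, OF eq] by (simp add: square_integrable_def)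
  moreover have "integrable M (\<lambda>x. ((f \<circ> frac) x)\<^sup>2)"
    using f Bochner_Integration.integrable_cong[of M M "\<lambda>x. ((f \<circ> frac) x)\<^sup>2" "\<lambda>x. (f x)\<^sup>2"] eq
    by (simp add: square_integrable_def)
  ultimately show "f \<circ> frac \<in> torus_L2 M" by (simp add: torus_L2_def)
qed

text \<open>
  The primitives of the derivatives converge uniformly, so the initial values \<open>\<phi> n 0\<close>, seen as constant
  functions, converge in \<open>L\<^sup>2\<close> to \<open>f - primitive F\<close>; a limit of constants is constant.
\<close>

lemma is_weak_DW_of_limit:
  assumes \<phi>: "\<And>n. \<phi> n \<in> \<D>" and f: "square_integrable \<nu> f" "L2_tendsto \<nu> \<phi> f"
    and F: "F \<in> torus_L2 \<mu>" "L2_tendsto \<mu> (\<lambda>n. DW W (\<phi> n)) F"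
  shows "is_weak_DW W V f F"
proof -
  note F_sq = torus_L2_square_integrable[OF F(1)]
  note \<phi>_sq = frakD_square_integrable[OF \<phi>] and \<Phi>_sq = frakD_DW_square_integrable[OF \<phi>]
  have "(\<lambda>n. LINT y|\<mu>. DW W (\<phi> n) y * 1) \<longlonglongrightarrow> (LINT y|\<mu>. F y * 1)"
    by (intro L2_tendsto_inner \<Phi>_sq F_sq \<mu>.square_integrable_const F)
  then have "(\<lambda>n. 0) \<longlonglongrightarrow> (LINT y|\<mu>. F y)" by (simp add: frakD_integral_DW[OF \<phi>])
  then have F0: "(LINT y|\<mu>. F y) = 0" by (simp add: LIMSEQ_const_iff)
  define h where "h x = f x - primitive F x" for x
  have h_sq: "square_integrable \<nu> h"
    unfolding h_def by (intro square_integrable_diff f primitive_square_integrable F_sq)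
  define m where "m = measure \<mu> (space \<mu>)"
  define d where "d n = (LINT y|\<mu>. (DW W (\<phi> n) y - F y)\<^sup>2)" for n
  have le: "(LINT x|\<nu>. (\<phi> n 0 - h x)\<^sup>2)
      \<le> 2 * (LINT x|\<nu>. (\<phi> n x - f x)\<^sup>2) + 2 * (m * d n * measure \<nu> (space \<nu>))" for n
  proof -
    let ?P = "\<lambda>x. primitive F x - primitive (DW W (\<phi> n)) x"
    have P_sq: "square_integrable \<nu> ?P"
      by (intro square_integrable_diff primitive_square_integrable F_sq \<Phi>_sq)
    have "(LINT x|\<nu>. (\<phi> n 0 - h x)\<^sup>2) = (LINT x|\<nu>. ((\<phi> n x - f x) + ?P x)\<^sup>2)"
    proof (intro Bochner_Integration.integral_cong refl)
      fix x assume "x \<in> space \<nu>"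
      then have "\<phi> n x = \<phi> n 0 + primitive (DW W (\<phi> n)) x"
        unfolding primitive_def by (intro frakD_eq_integral[OF \<phi>]) (simp add: space_\<nu>)
      then show "(\<phi> n 0 - h x)\<^sup>2 = ((\<phi> n x - f x) + ?P x)\<^sup>2"
        by (simp add: h_def algebra_simps)
    qed
    also have "\<dots> \<le> 2 * (LINT x|\<nu>. (\<phi> n x - f x)\<^sup>2) + 2 * (LINT x|\<nu>. (?P x)\<^sup>2)"
      by (intro integral_square_add_le square_integrable_diff \<phi>_sq f P_sq)
    also have "(LINT x|\<nu>. (?P x)\<^sup>2) \<le> (LINT x|\<nu>. m * d n)"
    proof (intro integral_mono square_integrable_square P_sq)
      fix x assume "x \<in> space \<nu>"
      then have x: "x < 1" by (simp add: space_\<nu>)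
      have "(primitive (\<lambda>y. DW W (\<phi> n) y - F y) x)\<^sup>2 \<le> m * d n"
        unfolding m_def d_def by (intro primitive_square_le square_integrable_diff \<Phi>_sq F_sq x)
      then show "(?P x)\<^sup>2 \<le> m * d n"
        by (simp add: primitive_diff[OF \<Phi>_sq F_sq x] power2_commute)
    qed simp
    finally show ?thesis by (simp add: mult_ac)
  qed
  have "(\<lambda>n. 2 * (LINT x|\<nu>. (\<phi> n x - f x)\<^sup>2) + 2 * (m * d n * measure \<nu> (space \<nu>)))
      \<longlonglongrightarrow> 2 * 0 + 2 * (m * 0 * measure \<nu> (space \<nu>))"
    using f(2) F(2) unfolding L2_tendsto_def d_def by (intro tendsto_intros)
  then have lim0: "(\<lambda>n. 2 * (LINT x|\<nu>. (\<phi> n x - f x)\<^sup>2) + 2 * (m * d n * measure \<nu> (space \<nu>)))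
      \<longlonglongrightarrow> 0" by simp
  have "(\<lambda>n. LINT x|\<nu>. (\<phi> n 0 - h x)\<^sup>2) \<longlonglongrightarrow> 0"
    by (rule tendsto_sandwich[OF _ _ tendsto_const lim0]) (simp_all add: le)
  then have to_h: "L2_tendsto \<nu> (\<lambda>n x. \<phi> n 0) h" by (simp add: L2_tendsto_def)
  then have "(\<lambda>n. LINT x|\<nu>. \<phi> n 0 * 1) \<longlonglongrightarrow> (LINT x|\<nu>. h x * 1)"
    by (intro L2_tendsto_inner \<nu>.square_integrable_const h_sq)
  then have "(\<lambda>n. measure \<nu> (space \<nu>) * \<phi> n 0) \<longlonglongrightarrow> (LINT x|\<nu>. h x)" by simp
  from tendsto_divide[OF this tendsto_const[of "measure \<nu> (space \<nu>)"]]
  obtain c where c: "(\<lambda>n. \<phi> n 0) \<longlonglongrightarrow> c" using \<nu>_space_pos by auto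
  then have "(\<lambda>n. measure \<nu> (space \<nu>) * (\<phi> n 0 - c)\<^sup>2) \<longlonglongrightarrow> measure \<nu> (space \<nu>) * (c - c)\<^sup>2"
    by (intro tendsto_intros)
  then have "L2_tendsto \<nu> (\<lambda>n x. \<phi> n 0) (\<lambda>x. c)" by (simp add: L2_tendsto_def)
  then have "AE x in \<nu>. h x = c"
    by (intro L2_tendsto_unique[OF \<nu>.square_integrable_const h_sq to_h] \<nu>.square_integrable_const)
  then have "AE x in \<nu>. f x = c + (LINT y:{0<..x}|\<mu>. F y)"
    by eventually_elim (simp add: h_def primitive_def algebra_simps)
  then show ?thesis using F(1) F0 by (auto simp: is_weak_DW_def torus_L2_0_def)
qed

text \<open>
  A primitive is right continuous and \<open>dV\<close> charges every interval to the right of a point, so a primitive that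
  is a.e. constant is constant everywhere on \<open>[0,1)\<close>; its value at \<open>0\<close> is \<open>0\<close>. Hence the
  integrals of \<open>h\<close> over all rays vanish.
\<close>

lemma primitive_AE_const_imp_zero:
  assumes h: "square_integrable \<mu> h" and total: "(LINT y|\<mu>. h y) = 0"
    and ae: "AE x in \<nu>. primitive h x = d"
  shows "AE y in \<mu>. h y = 0"
proof -
  have h_int: "integrable \<mu> h" by (rule \<mu>.square_integrable_integrable[OF h])
  have P_const: "primitive h x = d" if x: "0 \<le> x" "x < 1" for x
  proof (rule ccontr)
    assume ne: "primitive h x \<noteq> d"
    define Q where "Q = (LINT y|\<mu>. (h y)\<^sup>2)"
    have step: "(primitive h y - primitive h x)\<^sup>2 \<le> (W y - W x) * Q" if y: "x < y" "y < 1" for y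
    proof -
      have A: "{0<..x} \<in> sets \<mu>" "{x<..y} \<in> sets \<mu>" using x y by (auto intro!: sets_\<mu>I)
      have "{0<..y} = {0<..x} \<union> {x<..y}" using x y by auto
      then have "primitive h y = primitive h x + (LINT z:{x<..y}|\<mu>. h z)"
        unfolding primitive_def using A by (simp add: set_integral_Un set_integrable_\<mu> h_int)
      moreover have "measure \<mu> {x<..y} = W y - W x"
        using emeasure_dW_Ioc[OF W_strict W_cadlag, of x y] x y W_mono by (simp add: measure_def mono_def)
      ultimately show ?thesis using set_integral_square_le[OF h A(2)] by (simp add: Q_def)
    qed
    have "((\<lambda>y. (W y - W x) * Q) \<longlongrightarrow> (W x - W x) * Q) (at_right x)"
      using W_rc[of x] unfolding continuous_within by (intro tendsto_intros)
    moreover have "(W x - W x) * Q < (primitive h x - d)\<^sup>2" using ne by simp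
    ultimately have "\<forall>\<^sub>F y in at_right x. (W y - W x) * Q < (primitive h x - d)\<^sup>2"
      by (rule order_tendstoD)
    then obtain b where b: "x < b" "\<And>y. x < y \<Longrightarrow> y < b \<Longrightarrow> (W y - W x) * Q < (primitive h x - d)\<^sup>2"
      unfolding eventually_at_right_field by auto
    define b' where "b' = min b 1"
    define a where "a = (x + b') / 2"
    have ab: "x < a" "a < b'" "b' \<le> b" "b' \<le> 1" using b(1) x by (auto simp: a_def b'_def min_def)
    have far: "primitive h y \<noteq> d" if "y \<in> {a..<b'}" for y
      using step[of y] b(2)[of y] ab that by (auto simp: power2_commute)
    have S: "{a..<b'} \<in> sets \<nu>" using ab x by (intro sets_\<nu>I) auto
    have "AE y in \<nu>. y \<notin> {a..<b'}" using ae by eventually_elim (use far in blast)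
    then have "{a..<b'} \<in> null_sets \<nu>" by (rule iffD2[OF AE_iff_null_sets[OF S]])
    then have "emeasure \<nu> {a..<b'} = 0" by (rule null_setsD1)
    then have "V b' - V a \<le> 0" using emeasure_\<nu>_Ico[of a b'] ab x by (simp add: ennreal_eq_0_iff)
    then show False using strict_monoD[OF V_strict ab(2)] by simp
  qed
  have "d = 0" using P_const[of 0] by (simp add: primitive_def set_lebesgue_integral_def)
  then have P0: "primitive h x = 0" if "0 \<le> x" "x < 1" for x using P_const that by simp
  let ?M = "interval_measure W"
  \<comment> \<open>The extension of \<open>h\<close> by zero to the whole line, where Borel sets and rays are available.\<close>
  let ?H = "\<lambda>y. indicator {0..<1} y *\<^sub>R h y"
  have \<mu>_atMost: "(LINT y:{..x}|\<mu>. h y) = 0" for x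
  proof -
    consider "x < 0" | "0 \<le> x" "x < 1" | "1 \<le> x" by linarith
    then show ?thesis
    proof cases
      case 1
      then have "(LINT y:{..x}|\<mu>. h y) = (LINT y|\<mu>. 0)"
        unfolding set_lebesgue_integral_def
        by (intro Bochner_Integration.integral_cong) (auto simp: space_\<mu> indicator_def)
      then show ?thesis by simp
    next
      case 2
      have hm: "h \<in> borel_measurable \<mu>" using h by (simp add: square_integrable_def)
      have "(LINT y:{..x}|\<mu>. h y) = primitive h x"
        unfolding set_lebesgue_integral_def primitive_def
      proof (rule integral_cong_AE)
        show "AE y in \<mu>. indicator {..x} y *\<^sub>R h y = indicator {0<..x} y *\<^sub>R h y"
          using \<mu>_AE_pos by eventually_elim (auto simp: indicator_def)
        show "(\<lambda>y. indicator {..x} y *\<^sub>R h y) \<in> borel_measurable \<mu>"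
          by (intro borel_measurable_scaleR[OF _ hm] borel_measurable_\<mu>) auto
        show "(\<lambda>y. indicator {0<..x} y *\<^sub>R h y) \<in> borel_measurable \<mu>"
          by (intro borel_measurable_scaleR[OF _ hm] borel_measurable_\<mu>) auto
      qed
      then show ?thesis using P0 2 by simp
    next
      case 3
      then have "(LINT y:{..x}|\<mu>. h y) = (LINT y|\<mu>. h y)"
        unfolding set_lebesgue_integral_def
        by (intro Bochner_Integration.integral_cong) (auto simp: space_\<mu> indicator_def)
      then show ?thesis using total by simp
    qed
  qed
  have "AE y in ?M. ?H y = 0"
  proof (rule AE_zero_of_integral_atMost)
    show "integrable ?M ?H" using h_int unfolding dW_def by (simp add: integrable_restrict_space)
    show "(LINT y|?M. ?H y) = 0" using total unfolding dW_def by (simp add: integral_restrict_space)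
    show "(LINT y:{..x}|?M. ?H y) = 0" for x
      using \<mu>_atMost[of x] unfolding dW_def by (simp add: set_integral_restrict_space)
  qed simp
  then have "AE y in ?M. y \<in> {0..<1} \<longrightarrow> h y = 0" by eventually_elim (auto split: split_indicator_asm)
  then show ?thesis unfolding dW_def by (simp add: AE_restrict_space_iff)
qed

lemma is_weak_DW_unique:
  assumes "is_weak_DW W V f F" "is_weak_DW W V f G"
  shows "AE y in \<mu>. F y = G y"
proof -
  have sq: "square_integrable \<mu> F" "square_integrable \<mu> G"
    and tot: "(LINT y|\<mu>. F y) = 0" "(LINT y|\<mu>. G y) = 0"
    using assms torus_L2_square_integrable by (auto simp: is_weak_DW_def torus_L2_0_def)
  obtain c d where "AE x in \<nu>. f x = c + primitive F x" "AE x in \<nu>. f x = d + primitive G x"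
    using assms unfolding is_weak_DW_def primitive_def by blast
  then have "AE x in \<nu>. primitive (\<lambda>y. F y - G y) x = d - c"
    using AE_space by eventually_elim (simp add: primitive_diff[OF sq] space_\<nu>)
  then have "AE y in \<mu>. F y - G y = 0"
    using sq tot \<mu>.square_integrable_integrable
    by (intro primitive_AE_const_imp_zero square_integrable_diff) auto
  then show ?thesis by simp
qed

lemma energy_norm_diff:
  assumes "\<phi> \<in> \<D>" "\<psi> \<in> \<D>"
  shows "energy_norm W V (\<lambda>x. \<phi> x - \<psi> x)
    = sqrt ((LINT x|\<nu>. (\<phi> x - \<psi> x)\<^sup>2) + (LINT x|\<mu>. (DW W \<phi> x - DW W \<psi> x)\<^sup>2))"
  unfolding energy_norm_def frakD_energy[OF frakD_diff(1)[OF assms]]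
  unfolding frakD_diff(2)[OF assms] ..

lemma H_spaceI:
  assumes f: "f \<in> torus_L2 \<nu>" and \<phi>: "\<And>n. \<phi> n \<in> \<D>" and lim: "L2_tendsto \<nu> \<phi> f"
    and Cau: "L2_Cauchy \<mu> (\<lambda>n. DW W (\<phi> n))"
  shows "f \<in> H_space W V"
  unfolding H_space_def
proof (intro CollectI conjI exI[of _ \<phi>] allI impI)
  show "(\<lambda>n. L2_norm \<nu> (\<lambda>x. \<phi> n x - f x)) \<longlonglongrightarrow> 0"
    using tendsto_real_sqrt[OF lim[unfolded L2_tendsto_def]]
    by (simp add: L2_norm_def L2_inner_def power2_eq_square)
  fix e :: real assume e: "0 < e"
  have Cau\<phi>: "L2_Cauchy \<nu> \<phi>"
    by (rule L2_tendsto_Cauchy[OF frakD_square_integrable[OF \<phi>] torus_L2_square_integrable[OF f] lim])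
  have "0 < e\<^sup>2 / 2" using e by simp
  obtain N1 where N1: "\<forall>m\<ge>N1. \<forall>n\<ge>N1. (LINT x|\<nu>. (\<phi> m x - \<phi> n x)\<^sup>2) < e\<^sup>2 / 2"
    using Cau\<phi> \<open>0 < e\<^sup>2 / 2\<close> unfolding L2_Cauchy_def by blast
  obtain N2 where N2: "\<forall>m\<ge>N2. \<forall>n\<ge>N2. (LINT x|\<mu>. (DW W (\<phi> m) x - DW W (\<phi> n) x)\<^sup>2) < e\<^sup>2 / 2"
    using Cau \<open>0 < e\<^sup>2 / 2\<close> unfolding L2_Cauchy_def by blast
  have "energy_norm W V (\<lambda>x. \<phi> m x - \<phi> n x) < e" if "max N1 N2 \<le> m" "max N1 N2 \<le> n" for m n
  proof -
    have "(LINT x|\<nu>. (\<phi> m x - \<phi> n x)\<^sup>2) + (LINT x|\<mu>. (DW W (\<phi> m) x - DW W (\<phi> n) x)\<^sup>2) < e\<^sup>2"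
      using N1[rule_format, of m n] N2[rule_format, of m n] that by simp
    then show ?thesis unfolding energy_norm_diff[OF \<phi> \<phi>] using e by (intro real_less_lsqrt) auto
  qed
  then show "\<exists>N. \<forall>m\<ge>N. \<forall>n\<ge>N. energy_norm W V (\<lambda>x. \<phi> m x - \<phi> n x) < e" by blast
qed (use assms in auto)

text \<open>
  Uniqueness of weak derivatives identifies the representative picked by the choice operator with the limit
  of the classical derivatives.
\<close>

lemma
  assumes \<phi>: "\<And>n. \<phi> n \<in> \<D>" and f_sq: "square_integrable \<nu> f" and lim: "L2_tendsto \<nu> \<phi> f"
    and Cau: "L2_Cauchy \<mu> (\<lambda>n. DW W (\<phi> n))"
  shows is_weak_DW_weak_DW_of_limit: "is_weak_DW W V f (weak_DW W V f)"
    and L2_tendsto_weak_DW: "L2_tendsto \<mu> (\<lambda>n. DW W (\<phi> n)) (weak_DW W V f)"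
proof -
  note \<Phi>_sq = frakD_DW_square_integrable[OF \<phi>]
  obtain F0 where F0: "square_integrable \<mu> F0" "L2_tendsto \<mu> (\<lambda>n. DW W (\<phi> n)) F0"
    using \<mu>.L2_complete[of "\<lambda>n. DW W (\<phi> n)", OF \<Phi>_sq Cau] by blast
  obtain F where F: "F \<in> torus_L2 \<mu>" and eq: "\<And>x. x \<in> space \<mu> \<Longrightarrow> F x = F0 x"
    using torus_L2_representative[OF F0(1) space_\<mu>] by blast
  note F_sq = torus_L2_square_integrable[OF F]
  have limF: "L2_tendsto \<mu> (\<lambda>n. DW W (\<phi> n)) F"
    by (rule L2_tendsto_cong_AE[of _ "\<lambda>n. DW W (\<phi> n)", OF \<Phi>_sq F0(1) F_sq _ F0(2)]) (simp add: eq AE_I2)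
  have wF: "is_weak_DW W V f F" by (rule is_weak_DW_of_limit[OF \<phi> f_sq lim F limF])
  then show w: "is_weak_DW W V f (weak_DW W V f)" unfolding weak_DW_def by (rule someI[of "is_weak_DW W V f"])
  from w have w_sq: "square_integrable \<mu> (weak_DW W V f)"
    by (intro torus_L2_square_integrable) (simp add: is_weak_DW_def torus_L2_0_def)
  show "L2_tendsto \<mu> (\<lambda>n. DW W (\<phi> n)) (weak_DW W V f)"
    by (rule L2_tendsto_cong_AE[of _ "\<lambda>n. DW W (\<phi> n)", OF \<Phi>_sq F_sq w_sq is_weak_DW_unique[OF wF w] limF])
qed

lemma H_space_approx:
  assumes f: "f \<in> H_space W V"
  obtains \<phi> where "\<And>n. \<phi> n \<in> \<D>" "L2_tendsto \<nu> \<phi> f" "L2_tendsto \<mu> (\<lambda>n. DW W (\<phi> n)) (weak_DW W V f)"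
    and "is_weak_DW W V f (weak_DW W V f)"
proof -
  obtain \<phi> :: "nat \<Rightarrow> real \<Rightarrow> real" where \<phi>: "\<And>n. \<phi> n \<in> \<D>"
    and Cau: "\<forall>e>0. \<exists>N. \<forall>m\<ge>N. \<forall>n\<ge>N. energy_norm W V (\<lambda>x. \<phi> m x - \<phi> n x) < e"
    and lim: "(\<lambda>n. L2_norm \<nu> (\<lambda>x. \<phi> n x - f x)) \<longlonglongrightarrow> 0" and fL: "f \<in> torus_L2 \<nu>"
    using f unfolding H_space_def by blast
  have "(\<lambda>n. (L2_norm \<nu> (\<lambda>x. \<phi> n x - f x))\<^sup>2) \<longlonglongrightarrow> 0\<^sup>2" using lim by (rule tendsto_power)
  then have lim': "L2_tendsto \<nu> \<phi> f"
    by (simp add: L2_tendsto_def L2_norm_def L2_inner_def power2_eq_square[symmetric])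
  have Cau': "L2_Cauchy \<mu> (\<lambda>n. DW W (\<phi> n))"
    unfolding L2_Cauchy_def
  proof (intro allI impI)
    fix e :: real assume "0 < e"
    then obtain N where N: "\<And>m n. N \<le> m \<Longrightarrow> N \<le> n \<Longrightarrow> energy_norm W V (\<lambda>x. \<phi> m x - \<phi> n x) < sqrt e"
      using Cau by (metis real_sqrt_gt_zero)
    have "(LINT x|\<mu>. (DW W (\<phi> m) x - DW W (\<phi> n) x)\<^sup>2) < e" if "N \<le> m" "N \<le> n" for m n
    proof -
      have "(LINT x|\<nu>. (\<phi> m x - \<phi> n x)\<^sup>2) + (LINT x|\<mu>. (DW W (\<phi> m) x - DW W (\<phi> n) x)\<^sup>2) < e"
        using N[OF that] unfolding energy_norm_diff[OF \<phi> \<phi>] by simp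
      moreover have "0 \<le> (LINT x|\<nu>. (\<phi> m x - \<phi> n x)\<^sup>2)" by simp
      ultimately show ?thesis by linarith
    qed
    then show "\<exists>N. \<forall>m\<ge>N. \<forall>n\<ge>N. (LINT x|\<mu>. (DW W (\<phi> m) x - DW W (\<phi> n) x)\<^sup>2) < e" by blast
  qed
  note f_sq = torus_L2_square_integrable[OF fL]
  show ?thesis
    by (rule that[of \<phi>, OF \<phi> lim' L2_tendsto_weak_DW[of \<phi> f, OF \<phi> f_sq lim' Cau']
      is_weak_DW_weak_DW_of_limit[of \<phi> f, OF \<phi> f_sq lim' Cau']])
qed

end

section \<open>The bilinear form and the variational problem\<close>

locale torus_operator = torus_pair W V for W V :: "real \<Rightarrow> real" +
  fixes A \<kappa> :: "real \<Rightarrow> real" and A0 K :: real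
  assumes A_meas: "A \<in> borel_measurable borel" and A0_pos: "0 < A0"
    and A_bounds: "\<And>x. A0 \<le> A x \<and> A x \<le> K"
    and \<kappa>_meas: "\<kappa> \<in> borel_measurable borel" and \<kappa>_bounded: "bounded (range \<kappa>)"
begin

text \<open>
  The bilinear form with the derivatives \<open>F\<close>, \<open>G\<close> of \<open>u\<close>, \<open>v\<close> as separate arguments, so that it can be evaluated
  with classical as well as with weak derivatives.
\<close>

definition form :: "(real \<Rightarrow> real) \<Rightarrow> (real \<Rightarrow> real) \<Rightarrow> (real \<Rightarrow> real) \<Rightarrow> (real \<Rightarrow> real) \<Rightarrow> real" where
  "form F u G v = (LINT x|\<mu>. A x * F x * G x) + (LINT x|\<nu>. (\<kappa> x)\<^sup>2 * u x * v x)"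

lemma B_form_eq_form: "B_form W V A \<kappa> u v = form (weak_DW W V u) u (weak_DW W V v) v"
  by (simp add: B_form_def form_def)

lemma form_sym: "form F u G v = form G v F u"
  unfolding form_def by (simp add: mult.commute mult.left_commute)

lemma A_mult_square_integrable: "square_integrable \<mu> F \<Longrightarrow> square_integrable \<mu> (\<lambda>x. A x * F x)"
  by (rule square_integrable_bounded_mult[OF borel_measurable_\<mu>[OF A_meas], of K])
    (use A_bounds A0_pos in \<open>smt (verit, best)\<close>)

lemma \<kappa>_bound: obtains k where "\<And>x. (\<kappa> x)\<^sup>2 \<le> k" "0 \<le> k"
proof -
  obtain k0 where "\<And>x. \<bar>\<kappa> x\<bar> \<le> k0" using \<kappa>_bounded by (auto simp: bounded_iff)
  then have "(\<kappa> x)\<^sup>2 \<le> k0\<^sup>2" for x using power_mono[of "\<bar>\<kappa> x\<bar>" k0 2] by simp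
  then show ?thesis using that[of "k0\<^sup>2"] by simp
qed

lemma \<kappa>_mult_square_integrable: "square_integrable \<nu> u \<Longrightarrow> square_integrable \<nu> (\<lambda>x. (\<kappa> x)\<^sup>2 * u x)"
proof -
  assume u: "square_integrable \<nu> u"
  obtain k where "\<And>x. (\<kappa> x)\<^sup>2 \<le> k" using \<kappa>_bound by blast
  then show ?thesis
    by (intro square_integrable_bounded_mult[of _ _ k, OF _ _ u] borel_measurable_\<nu> borel_measurable_power \<kappa>_meas) auto
qed

lemma form_integrable:
  "square_integrable \<mu> F \<Longrightarrow> square_integrable \<mu> G \<Longrightarrow> integrable \<mu> (\<lambda>x. A x * F x * G x)"
  "square_integrable \<nu> u \<Longrightarrow> square_integrable \<nu> v \<Longrightarrow> integrable \<nu> (\<lambda>x. (\<kappa> x)\<^sup>2 * u x * v x)"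
  using square_integrable_mult[OF A_mult_square_integrable] square_integrable_mult[OF \<kappa>_mult_square_integrable]
  by blast+

lemma form_comb:
  assumes "square_integrable \<mu> F" "square_integrable \<mu> F'" "square_integrable \<mu> G"
    "square_integrable \<nu> u" "square_integrable \<nu> u'" "square_integrable \<nu> v"
  shows "form (\<lambda>x. F x + t * F' x) (\<lambda>x. u x + t * u' x) G v = form F u G v + t * form F' u' G v"
proof -
  have "A x * (F x + t * F' x) * G x = A x * F x * G x + t * (A x * F' x * G x)"
    "(\<kappa> x)\<^sup>2 * (u x + t * u' x) * v x = (\<kappa> x)\<^sup>2 * u x * v x + t * ((\<kappa> x)\<^sup>2 * u' x * v x)" for x
    by (simp_all add: algebra_simps)
  then show ?thesis using assms
    by (simp only: form_def) (simp add: form_integrable distrib_left)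
qed

lemma form_diff:
  assumes "square_integrable \<mu> F" "square_integrable \<mu> F'" "square_integrable \<mu> G"
    "square_integrable \<nu> u" "square_integrable \<nu> u'" "square_integrable \<nu> v"
  shows "form (\<lambda>x. F x - F' x) (\<lambda>x. u x - u' x) G v = form F u G v - form F' u' G v"
  using form_comb[OF assms, of "-1"] by simp

lemma form_tendsto:
  assumes "\<And>n. square_integrable \<mu> (\<Phi> n)" "square_integrable \<mu> F" "square_integrable \<mu> G" "L2_tendsto \<mu> \<Phi> F"
    and "\<And>n. square_integrable \<nu> (\<phi> n)" "square_integrable \<nu> u" "square_integrable \<nu> v" "L2_tendsto \<nu> \<phi> u"
  shows "(\<lambda>n. form (\<Phi> n) (\<phi> n) G v) \<longlonglongrightarrow> form F u G v"
proof -
  have "(\<lambda>n. LINT x|\<mu>. \<Phi> n x * (A x * G x)) \<longlonglongrightarrow> (LINT x|\<mu>. F x * (A x * G x))"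
    by (rule L2_tendsto_inner) (use assms A_mult_square_integrable in auto)
  moreover have "(\<lambda>n. LINT x|\<nu>. \<phi> n x * ((\<kappa> x)\<^sup>2 * v x)) \<longlonglongrightarrow> (LINT x|\<nu>. u x * ((\<kappa> x)\<^sup>2 * v x))"
    by (rule L2_tendsto_inner) (use assms \<kappa>_mult_square_integrable in auto)
  ultimately have "(\<lambda>n. (LINT x|\<mu>. \<Phi> n x * (A x * G x)) + (LINT x|\<nu>. \<phi> n x * ((\<kappa> x)\<^sup>2 * v x)))
      \<longlonglongrightarrow> (LINT x|\<mu>. F x * (A x * G x)) + (LINT x|\<nu>. u x * ((\<kappa> x)\<^sup>2 * v x))"
    by (rule tendsto_add)
  then show ?thesis unfolding form_def by (simp only: mult_ac)
qed

lemma A_energy_nonneg: "0 \<le> (LINT x|\<mu>. A x * F x * F x)"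
proof (rule Bochner_Integration.integral_nonneg)
  fix x have "0 \<le> A x" using A_bounds[of x] A0_pos by linarith
  then show "0 \<le> A x * F x * F x" by (simp add: mult.assoc)
qed

lemma \<kappa>_energy_nonneg: "0 \<le> (LINT x|\<nu>. (\<kappa> x)\<^sup>2 * u x * u x)"
  by (rule Bochner_Integration.integral_nonneg) (simp add: mult.assoc)

lemma form_nonneg: "0 \<le> form F u F u"
  unfolding form_def using A_energy_nonneg \<kappa>_energy_nonneg by (rule add_nonneg_nonneg)

lemma gradient_le_form:
  assumes F: "square_integrable \<mu> F"
  shows "A0 * (LINT x|\<mu>. (F x)\<^sup>2) \<le> form F u F u"
proof -
  have "(LINT x|\<mu>. A0 * (F x)\<^sup>2) \<le> (LINT x|\<mu>. A x * F x * F x)"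
    using A_bounds
    by (intro integral_mono form_integrable F integrable_mult_right square_integrable_square)
      (simp add: power2_eq_square mult.assoc mult_right_mono)
  then show ?thesis using \<kappa>_energy_nonneg[of u] by (simp add: form_def)
qed

lemma H_space_torus_L2: "u \<in> H_space W V \<Longrightarrow> u \<in> torus_L2 \<nu>"
  by (simp add: H_space_def)

lemma H_space_square_integrable: "u \<in> H_space W V \<Longrightarrow> square_integrable \<nu> u"
  by (intro torus_L2_square_integrable H_space_torus_L2)

lemma is_weak_DW_square_integrable: "is_weak_DW W V u F \<Longrightarrow> square_integrable \<mu> F"
  by (intro torus_L2_square_integrable) (simp add: is_weak_DW_def torus_L2_0_def)

lemma H_space_is_weak_DW: "u \<in> H_space W V \<Longrightarrow> is_weak_DW W V u (weak_DW W V u)"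
  using H_space_approx by blast

lemma weak_DW_square_integrable: "u \<in> H_space W V \<Longrightarrow> square_integrable \<mu> (weak_DW W V u)"
  by (rule is_weak_DW_square_integrable[OF H_space_is_weak_DW])

text \<open>
  Every element of \<open>H_space\<close> is approximated by classical functions together with its derivative, hence
  classical test functions suffice.
\<close>

lemma weak_solutionI:
  assumes u: "u \<in> H_space W V" and f: "square_integrable \<nu> f"
    and test: "\<And>\<phi>. \<phi> \<in> \<D> \<Longrightarrow> form (weak_DW W V u) u (DW W \<phi>) \<phi> = L2_inner \<nu> f \<phi>"
  shows "weak_solution W V A \<kappa> f u"
  unfolding weak_solution_def
proof (intro conjI ballI u)
  fix v assume v: "v \<in> H_space W V"
  obtain \<phi> where \<phi>: "\<And>n. \<phi> n \<in> \<D>" and lim: "L2_tendsto \<nu> \<phi> v"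
    "L2_tendsto \<mu> (\<lambda>n. DW W (\<phi> n)) (weak_DW W V v)"
    using H_space_approx[OF v] by blast
  note sq = weak_DW_square_integrable[OF u] weak_DW_square_integrable[OF v]
    H_space_square_integrable[OF u] H_space_square_integrable[OF v]
  have "(\<lambda>n. form (DW W (\<phi> n)) (\<phi> n) (weak_DW W V u) u) \<longlonglongrightarrow> form (weak_DW W V v) v (weak_DW W V u) u"
    by (rule form_tendsto) (use sq lim frakD_square_integrable[OF \<phi>] frakD_DW_square_integrable[OF \<phi>] in auto)
  moreover have "form (DW W (\<phi> n)) (\<phi> n) (weak_DW W V u) u = (LINT x|\<nu>. \<phi> n x * f x)" for n
    using test[OF \<phi>] by (simp add: form_sym[of "DW W (\<phi> n)"] L2_inner_def mult.commute)
  moreover have "(\<lambda>n. LINT x|\<nu>. \<phi> n x * f x) \<longlonglongrightarrow> (LINT x|\<nu>. v x * f x)"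
    by (rule L2_tendsto_inner) (use sq lim f frakD_square_integrable[OF \<phi>] in auto)
  ultimately have "form (weak_DW W V v) v (weak_DW W V u) u = (LINT x|\<nu>. v x * f x)"
    using LIMSEQ_unique by simp
  then show "B_form W V A \<kappa> u v = L2_inner \<nu> f v"
    by (simp add: B_form_eq_form form_sym[of "weak_DW W V u"] L2_inner_def mult.commute)
qed

text \<open>
  Coercivity bounds the functional \<open>(f, \<cdot>)\<close> by the form and turns form-Cauchy sequences into energy-Cauchy
  ones, whose limits belong to \<open>H_space\<close> by definition. A subspace \<open>S\<close> is allowed because for \<open>\<kappa> = 0\<close> the
  form is coercive only after constants have been removed.
\<close>

lemma coercive_solution:
  assumes S: "S \<subseteq> \<D>" "S \<noteq> {}"
    and comb: "\<And>u v t. u \<in> S \<Longrightarrow> v \<in> S \<Longrightarrow> (\<lambda>x. u x + t * v x) \<in> S"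
    and C: "0 \<le> C" and coercive: "\<And>\<phi>. \<phi> \<in> S \<Longrightarrow> (LINT x|\<nu>. (\<phi> x)\<^sup>2) \<le> C * form (DW W \<phi>) \<phi> (DW W \<phi>) \<phi>"
    and f: "square_integrable \<nu> f"
  obtains u where "u \<in> H_space W V"
    and "\<And>\<phi>. \<phi> \<in> S \<Longrightarrow> form (weak_DW W V u) u (DW W \<phi>) \<phi> = L2_inner \<nu> f \<phi>"
proof -
  define q where "q u v = form (DW W u) u (DW W v) v" for u v
  have D: "\<phi> \<in> S \<Longrightarrow> \<phi> \<in> \<D>" for \<phi> using S by blast
  note sq = frakD_square_integrable[OF D] frakD_DW_square_integrable[OF D]
  have diff: "(\<lambda>x. u x - v x) \<in> S" if "u \<in> S" "v \<in> S" for u v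
    using comb[OF that, of "-1"] by simp
  obtain u where uS: "\<And>n. u n \<in> S"
    and Cau: "\<And>e. 0 < e \<Longrightarrow> \<exists>N. \<forall>m\<ge>N. \<forall>n\<ge>N. q (\<lambda>x. u m x - u n x) (\<lambda>x. u m x - u n x) < e"
    and lim: "\<And>v. v \<in> S \<Longrightarrow> (\<lambda>n. q (u n) v) \<longlonglongrightarrow> L2_inner \<nu> f v"
  proof (rule minimizing_sequence_represents[OF S(2), of q "L2_inner \<nu> f" "(LINT x|\<nu>. (f x)\<^sup>2) * C"])
    fix u v w t assume uvw: "u \<in> S" "v \<in> S" "w \<in> S"
    show "q (\<lambda>x. u x + t * v x) w = q u w + t * q v w"
      unfolding q_def DW_comb[OF D[OF uvw(1)] D[OF uvw(2)]] using uvw by (intro form_comb sq)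
  next
    fix u v t assume uv: "u \<in> S" "v \<in> S"
    show "(\<lambda>x. u x + t * v x) \<in> S" using comb uv .
    show "q u v = q v u" unfolding q_def by (rule form_sym)
    have "f x * (u x + t * v x) = f x * u x + t * (f x * v x)" for x by (simp add: algebra_simps)
    then show "L2_inner \<nu> f (\<lambda>x. u x + t * v x) = L2_inner \<nu> f u + t * L2_inner \<nu> f v"
      using square_integrable_mult[OF f sq(1)] uv by (simp add: L2_inner_def)
  next
    fix v assume v: "v \<in> S"
    show "0 \<le> q v v" unfolding q_def by (rule form_nonneg)
    have "(L2_inner \<nu> f v)\<^sup>2 \<le> (LINT x|\<nu>. (f x)\<^sup>2) * (LINT x|\<nu>. (v x)\<^sup>2)"
      unfolding L2_inner_def by (rule L2_Cauchy_Schwarz[OF f sq(1)[OF v]])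
    also have "\<dots> \<le> (LINT x|\<nu>. (f x)\<^sup>2) * (C * q v v)"
      unfolding q_def by (intro mult_left_mono coercive v) simp
    finally show "(L2_inner \<nu> f v)\<^sup>2 \<le> (LINT x|\<nu>. (f x)\<^sup>2) * C * q v v" by (simp add: mult.assoc)
  qed (use C that in auto)
  have CauV: "L2_Cauchy \<nu> u"
    unfolding L2_Cauchy_def
  proof (intro allI impI)
    fix e :: real assume e: "0 < e"
    then obtain N where N: "\<forall>m\<ge>N. \<forall>n\<ge>N. q (\<lambda>x. u m x - u n x) (\<lambda>x. u m x - u n x) < e / (C + 1)"
      using Cau[of "e / (C + 1)"] C by auto
    have "(LINT x|\<nu>. (u m x - u n x)\<^sup>2) < e" if "N \<le> m" "N \<le> n" for m n
    proof -
      define Q where "Q = q (\<lambda>x. u m x - u n x) (\<lambda>x. u m x - u n x)"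
      have "(LINT x|\<nu>. (u m x - u n x)\<^sup>2) \<le> C * Q"
        unfolding Q_def q_def by (intro coercive diff uS)
      also have "\<dots> \<le> (C + 1) * Q" unfolding Q_def q_def using form_nonneg by (intro mult_right_mono) auto
      also have "\<dots> < e" using N that C by (simp add: Q_def field_simps)
      finally show ?thesis .
    qed
    then show "\<exists>N. \<forall>m\<ge>N. \<forall>n\<ge>N. (LINT x|\<nu>. (u m x - u n x)\<^sup>2) < e" by blast
  qed
  have CauW: "L2_Cauchy \<mu> (\<lambda>n. DW W (u n))"
    unfolding L2_Cauchy_def
  proof (intro allI impI)
    fix e :: real assume e: "0 < e"
    then obtain N where N: "\<forall>m\<ge>N. \<forall>n\<ge>N. q (\<lambda>x. u m x - u n x) (\<lambda>x. u m x - u n x) < A0 * e"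
      using Cau[of "A0 * e"] A0_pos by auto
    have "(LINT x|\<mu>. (DW W (u m) x - DW W (u n) x)\<^sup>2) < e" if "N \<le> m" "N \<le> n" for m n
    proof -
      have "A0 * (LINT x|\<mu>. (DW W (u m) x - DW W (u n) x)\<^sup>2) \<le> q (\<lambda>x. u m x - u n x) (\<lambda>x. u m x - u n x)"
        unfolding q_def frakD_diff(2)[OF D[OF uS] D[OF uS]]
        by (intro gradient_le_form square_integrable_diff sq uS)
      also have "\<dots> < A0 * e" using N that by blast
      finally show ?thesis using A0_pos by simp
    qed
    then show "\<exists>N. \<forall>m\<ge>N. \<forall>n\<ge>N. (LINT x|\<mu>. (DW W (u m) x - DW W (u n) x)\<^sup>2) < e" by blast
  qed
  obtain w0 where w0: "square_integrable \<nu> w0" "L2_tendsto \<nu> u w0"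
    using \<nu>.L2_complete[of u, OF sq(1)[OF uS] CauV] by blast
  obtain w where w: "w \<in> torus_L2 \<nu>" and weq: "\<And>x. x \<in> space \<nu> \<Longrightarrow> w x = w0 x"
    using torus_L2_representative[OF w0(1) space_\<nu>] by blast
  note w_sq = torus_L2_square_integrable[OF w]
  have limw: "L2_tendsto \<nu> u w"
    by (rule L2_tendsto_cong_AE[of _ u, OF sq(1)[OF uS] w0(1) w_sq _ w0(2)]) (simp add: weq AE_I2)
  have wH: "w \<in> H_space W V" by (rule H_spaceI[of _ u, OF w D[OF uS] limw CauW])
  have limDw: "L2_tendsto \<mu> (\<lambda>n. DW W (u n)) (weak_DW W V w)"
    by (rule L2_tendsto_weak_DW[of u, OF D[OF uS] w_sq limw CauW])
  show ?thesis
  proof (rule that[OF wH])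
    fix \<phi> assume \<phi>: "\<phi> \<in> S"
    have "(\<lambda>n. q (u n) \<phi>) \<longlonglongrightarrow> form (weak_DW W V w) w (DW W \<phi>) \<phi>"
      unfolding q_def
      by (rule form_tendsto[of "\<lambda>n. DW W (u n)" _ _ u])
        (use sq[OF uS] sq[OF \<phi>] w_sq weak_DW_square_integrable[OF wH] limw limDw in auto)
    then show "form (weak_DW W V w) w (DW W \<phi>) \<phi> = L2_inner \<nu> f \<phi>"
      using lim[OF \<phi>] LIMSEQ_unique by blast
  qed
qed

lemma frakD_oscillation_le:
  assumes \<phi>: "\<phi> \<in> \<D>" and x: "x \<in> space \<nu>"
  shows "(\<phi> x - \<phi> 0)\<^sup>2 \<le> measure \<mu> (space \<mu>) / A0 * form (DW W \<phi>) \<phi> (DW W \<phi>) \<phi>"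
proof -
  have "\<phi> x - \<phi> 0 = primitive (DW W \<phi>) x"
    using frakD_eq_integral[OF \<phi>, of x] x by (simp add: primitive_def space_\<nu>)
  then have "(\<phi> x - \<phi> 0)\<^sup>2 \<le> measure \<mu> (space \<mu>) * (LINT y|\<mu>. (DW W \<phi> y)\<^sup>2)"
    using primitive_square_le[OF frakD_DW_square_integrable[OF \<phi>], of x] x by (simp add: space_\<nu>)
  also have "\<dots> \<le> measure \<mu> (space \<mu>) * (form (DW W \<phi>) \<phi> (DW W \<phi>) \<phi> / A0)"
    using gradient_le_form[OF frakD_DW_square_integrable[OF \<phi>], of \<phi>] A0_pos
    by (intro mult_left_mono) (simp_all add: field_simps)
  finally show ?thesis by simp
qed

lemma frakD_mean_oscillation_le:
  assumes \<phi>: "\<phi> \<in> \<D>"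
  shows "(LINT x|\<nu>. (\<phi> x - \<phi> 0)\<^sup>2)
    \<le> measure \<nu> (space \<nu>) * (measure \<mu> (space \<mu>) / A0) * form (DW W \<phi>) \<phi> (DW W \<phi>) \<phi>"
proof -
  have "(LINT x|\<nu>. (\<phi> x - \<phi> 0)\<^sup>2) \<le> (LINT x|\<nu>. measure \<mu> (space \<mu>) / A0 * form (DW W \<phi>) \<phi> (DW W \<phi>) \<phi>)"
    by (intro integral_mono square_integrable_square square_integrable_diff frakD_square_integrable
        \<nu>.square_integrable_const \<phi> frakD_oscillation_le) auto
  then show ?thesis by simp
qed

text \<open>
  The oscillation of \<open>\<phi>\<close> is controlled by its energy, so only \<open>c = \<phi> 0\<close> has to be bounded. From
  \<open>c\<^sup>2 \<le> 2 \<phi>\<^sup>2 + 2 (\<phi> - c)\<^sup>2\<close>, multiplied by \<open>\<kappa>\<^sup>2\<close> and integrated, \<open>c\<^sup>2\<close> times the positive number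
  \<open>\<integral>\<kappa>\<^sup>2 dV\<close> is bounded by the form.
\<close>

lemma coercive_of_nontrivial_potential:
  assumes ne: "\<not> (AE x in \<nu>. \<kappa> x = 0)"
  obtains C where "0 \<le> C"
    and "\<And>\<phi>. \<phi> \<in> \<D> \<Longrightarrow> (LINT x|\<nu>. (\<phi> x)\<^sup>2) \<le> C * form (DW W \<phi>) \<phi> (DW W \<phi>) \<phi>"
proof -
  obtain k where k: "\<And>x. (\<kappa> x)\<^sup>2 \<le> k" "0 \<le> k" using \<kappa>_bound by blast
  have \<kappa>_sq: "square_integrable \<nu> \<kappa>"
  proof -
    have "\<bar>\<kappa> x\<bar> \<le> sqrt k" for x using k(1)[of x] by (simp add: real_le_rsqrt)
    then show ?thesis by (intro \<nu>.square_integrable_bounded[of _ "sqrt k"] borel_measurable_\<nu> \<kappa>_meas)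
  qed
  define I where "I = (LINT x|\<nu>. (\<kappa> x)\<^sup>2)"
  have "I \<noteq> 0"
    unfolding I_def using integral_nonneg_eq_0_iff_AE[OF square_integrable_square[OF \<kappa>_sq]] ne by auto
  moreover have "0 \<le> I" unfolding I_def by simp
  ultimately have I: "0 < I" by simp
  define n where "n = measure \<nu> (space \<nu>)"
  define M where "M = n * (measure \<mu> (space \<mu>) / A0)"
  have n: "0 \<le> n" and M: "0 \<le> M" using A0_pos by (auto simp: n_def M_def)
  \<comment> \<open>\<open>M\<close> bounds the oscillation and \<open>(2 + 2 * (k * M)) / I\<close> the squared value at \<open>0\<close>, both relative to the form.\<close>
  define C where "C = 2 * M + 2 * ((2 + 2 * (k * M)) / I * n)"
  have C: "0 \<le> C" unfolding C_def using n M I k(2) by (intro add_nonneg_nonneg mult_nonneg_nonneg divide_nonneg_nonneg) auto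
  show ?thesis
  proof (rule that[OF C])
    fix \<phi> assume \<phi>: "\<phi> \<in> \<D>"
    define Q where "Q = form (DW W \<phi>) \<phi> (DW W \<phi>) \<phi>"
    define c where "c = \<phi> 0"
    note \<phi>_sq = frakD_square_integrable[OF \<phi>]
    have osc_sq: "square_integrable \<nu> (\<lambda>x. \<phi> x - c)"
      by (intro square_integrable_diff \<phi>_sq \<nu>.square_integrable_const)
    have osc: "(LINT x|\<nu>. (\<phi> x - c)\<^sup>2) \<le> M * Q"
      using frakD_mean_oscillation_le[OF \<phi>] by (simp add: c_def M_def n_def Q_def)
    have "(LINT x|\<nu>. c\<^sup>2 * (\<kappa> x)\<^sup>2) \<le> (LINT x|\<nu>. 2 * ((\<kappa> x)\<^sup>2 * \<phi> x * \<phi> x) + 2 * (k * (\<phi> x - c)\<^sup>2))"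
    proof (intro integral_mono)
      show "integrable \<nu> (\<lambda>x. c\<^sup>2 * (\<kappa> x)\<^sup>2)" using square_integrable_square[OF \<kappa>_sq] by simp
      show "integrable \<nu> (\<lambda>x. 2 * ((\<kappa> x)\<^sup>2 * \<phi> x * \<phi> x) + 2 * (k * (\<phi> x - c)\<^sup>2))"
        using form_integrable(2)[OF \<phi>_sq \<phi>_sq] square_integrable_square[OF osc_sq] by simp
      fix x
      have "c\<^sup>2 \<le> 2 * (\<phi> x * \<phi> x) + 2 * (\<phi> x - c)\<^sup>2"
        using zero_le_power2[of "2 * \<phi> x - c"] by (simp add: power2_eq_square algebra_simps)
      then have "(\<kappa> x)\<^sup>2 * c\<^sup>2 \<le> (\<kappa> x)\<^sup>2 * (2 * (\<phi> x * \<phi> x) + 2 * (\<phi> x - c)\<^sup>2)"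
        by (rule mult_left_mono) simp
      moreover have "(\<kappa> x)\<^sup>2 * (\<phi> x - c)\<^sup>2 \<le> k * (\<phi> x - c)\<^sup>2" by (intro mult_right_mono k) simp
      ultimately show "c\<^sup>2 * (\<kappa> x)\<^sup>2 \<le> 2 * ((\<kappa> x)\<^sup>2 * \<phi> x * \<phi> x) + 2 * (k * (\<phi> x - c)\<^sup>2)"
        by (simp add: distrib_left mult.assoc mult.commute[of "c\<^sup>2"])
    qed
    also have "\<dots> = 2 * (LINT x|\<nu>. (\<kappa> x)\<^sup>2 * \<phi> x * \<phi> x) + 2 * (k * (LINT x|\<nu>. (\<phi> x - c)\<^sup>2))"
      using form_integrable(2)[OF \<phi>_sq \<phi>_sq] square_integrable_square[OF osc_sq] by simp
    also have "\<dots> \<le> 2 * Q + 2 * (k * (M * Q))"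
      using A_energy_nonneg[of "DW W \<phi>"] k(2)
      by (intro add_mono mult_left_mono osc) (auto simp: Q_def form_def)
    finally have "c\<^sup>2 * I \<le> (2 + 2 * (k * M)) * Q" by (simp add: I_def algebra_simps)
    then have c_le: "c\<^sup>2 \<le> (2 + 2 * (k * M)) / I * Q" using I by (simp add: field_simps)
    have "(LINT x|\<nu>. (\<phi> x)\<^sup>2) = (LINT x|\<nu>. ((\<phi> x - c) + c)\<^sup>2)" by simp
    also have "\<dots> \<le> 2 * (LINT x|\<nu>. (\<phi> x - c)\<^sup>2) + 2 * (LINT x|\<nu>. c\<^sup>2)"
      by (intro integral_square_add_le osc_sq \<nu>.square_integrable_const)
    also have "\<dots> \<le> 2 * (M * Q) + 2 * ((2 + 2 * (k * M)) / I * Q * n)"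
      using mult_right_mono[OF c_le n] osc by (simp add: n_def mult.commute)
    also have "\<dots> = C * Q" by (simp add: C_def algebra_simps)
    finally show "(LINT x|\<nu>. (\<phi> x)\<^sup>2) \<le> C * form (DW W \<phi>) \<phi> (DW W \<phi>) \<phi>" by (simp add: Q_def)
  qed
qed

lemma weak_solution_exists_of_nontrivial_potential:
  assumes ne: "\<not> (AE x in \<nu>. \<kappa> x = 0)" and f: "f \<in> torus_L2 \<nu>"
  shows "\<exists>u. weak_solution W V A \<kappa> f u"
proof -
  note f_sq = torus_L2_square_integrable[OF f]
  obtain C where C: "0 \<le> C"
    "\<And>\<phi>. \<phi> \<in> \<D> \<Longrightarrow> (LINT x|\<nu>. (\<phi> x)\<^sup>2) \<le> C * form (DW W \<phi>) \<phi> (DW W \<phi>) \<phi>"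
    using coercive_of_nontrivial_potential[OF ne] by blast
  have "\<D> \<noteq> {}" using frakD_const by blast
  then obtain u where "u \<in> H_space W V" "\<And>\<phi>. \<phi> \<in> \<D> \<Longrightarrow> form (weak_DW W V u) u (DW W \<phi>) \<phi> = L2_inner \<nu> f \<phi>"
    using coercive_solution[OF subset_refl _ frakD_comb C f_sq] by metis
  then show ?thesis using weak_solutionI[OF _ f_sq] by blast
qed

lemma zero_potential_energy:
  assumes "AE x in \<nu>. \<kappa> x = 0"
  shows "(LINT x|\<nu>. (\<kappa> x)\<^sup>2 * u x * v x) = 0"
  by (rule integral_eq_zero_AE) (use assms in \<open>eventually_elim, simp\<close>)

text \<open>
  The problem is solved against test functions that vanish at \<open>0\<close>. Subtracting \<open>\<phi> 0\<close> from an arbitrary test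
  function changes neither side of the equation: the form does not see constants when \<open>\<kappa> = 0\<close>, and \<open>f\<close>
  has mean zero.
\<close>

lemma weak_solution_exists_of_zero_potential:
  assumes zero: "AE x in \<nu>. \<kappa> x = 0" and f: "f \<in> torus_L2 \<nu>" and mean: "(LINT x|\<nu>. f x) = 0"
  shows "\<exists>u. weak_solution W V A \<kappa> f u"
proof -
  note f_sq = torus_L2_square_integrable[OF f]
  define S where "S = {\<phi> \<in> \<D>. \<phi> 0 = 0}"
  define C where "C = measure \<nu> (space \<nu>) * (measure \<mu> (space \<mu>) / A0)"
  have C: "0 \<le> C" using A0_pos by (simp add: C_def)
  have SD: "S \<subseteq> \<D>" by (auto simp: S_def)
  have "(\<lambda>x. 0) \<in> S" using frakD_const by (simp add: S_def)
  then have S0: "S \<noteq> {}" by blast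
  have comb: "(\<lambda>x. u x + t * v x) \<in> S" if "u \<in> S" "v \<in> S" for u v t
    using that frakD_comb by (simp add: S_def)
  have coer: "(LINT x|\<nu>. (\<phi> x)\<^sup>2) \<le> C * form (DW W \<phi>) \<phi> (DW W \<phi>) \<phi>" if "\<phi> \<in> S" for \<phi>
    using frakD_mean_oscillation_le[of \<phi>] that by (simp add: S_def C_def)
  obtain u where u: "u \<in> H_space W V"
    and test: "\<And>\<phi>. \<phi> \<in> S \<Longrightarrow> form (weak_DW W V u) u (DW W \<phi>) \<phi> = L2_inner \<nu> f \<phi>"
    using coercive_solution[OF SD S0 comb C coer f_sq] by blast
  have "form (weak_DW W V u) u (DW W \<phi>) \<phi> = L2_inner \<nu> f \<phi>" if \<phi>: "\<phi> \<in> \<D>" for \<phi>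
  proof -
    have "(\<lambda>x. \<phi> x - \<phi> 0) \<in> S" using frakD_diff(1)[OF \<phi> frakD_const] by (simp add: S_def)
    from test[OF this] have "form (weak_DW W V u) u (DW W \<phi>) (\<lambda>x. \<phi> x - \<phi> 0) = L2_inner \<nu> f (\<lambda>x. \<phi> x - \<phi> 0)"
      by (simp add: frakD_diff(2)[OF \<phi> frakD_const] DW_const)
    moreover have "form (weak_DW W V u) u (DW W \<phi>) (\<lambda>x. \<phi> x - \<phi> 0) = form (weak_DW W V u) u (DW W \<phi>) \<phi>"
      by (simp add: form_def zero_potential_energy[OF zero])
    moreover have "L2_inner \<nu> f (\<lambda>x. \<phi> x - \<phi> 0) = L2_inner \<nu> f \<phi>"
      using square_integrable_mult[OF f_sq frakD_square_integrable[OF \<phi>]] \<nu>.square_integrable_integrable[OF f_sq] mean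
      by (simp add: L2_inner_def right_diff_distrib)
    ultimately show ?thesis by simp
  qed
  then show ?thesis using weak_solutionI[OF u f_sq] by blast
qed

section \<open>The kernel and the alternative\<close>

lemma const_H_space: "(\<lambda>x. c) \<in> H_space W V"
  and weak_DW_const: "AE x in \<mu>. weak_DW W V (\<lambda>x. c) x = 0"
proof -
  have sq: "square_integrable \<nu> (\<lambda>x. c)" by (rule \<nu>.square_integrable_const)
  have lim: "L2_tendsto \<nu> (\<lambda>n x. c) (\<lambda>x. c)" by (simp add: L2_tendsto_def)
  have Cau: "L2_Cauchy \<mu> (\<lambda>n. DW W (\<lambda>x. c))" by (simp add: L2_Cauchy_def)
  have "(\<lambda>x. c) \<in> torus_L2 \<nu>" by (rule frakD_torus_L2[OF frakD_const])
  then show H: "(\<lambda>x. c) \<in> H_space W V"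
    using H_spaceI[of "\<lambda>x. c" "\<lambda>n x. c"] frakD_const lim Cau by simp
  have "L2_tendsto \<mu> (\<lambda>n. DW W (\<lambda>x. c)) (weak_DW W V (\<lambda>x. c))"
    using L2_tendsto_weak_DW[of "\<lambda>n x. c" "\<lambda>x. c"] frakD_const sq lim Cau by simp
  then have w: "L2_tendsto \<mu> (\<lambda>n x. 0) (weak_DW W V (\<lambda>x. c))" by (simp only: DW_const)
  have z: "L2_tendsto \<mu> (\<lambda>n x. 0) (\<lambda>x. 0)" by (simp add: L2_tendsto_def)
  show "AE x in \<mu>. weak_DW W V (\<lambda>x. c) x = 0"
    using L2_tendsto_unique[of \<mu> "\<lambda>n x. 0" "weak_DW W V (\<lambda>x. c)" "\<lambda>x. 0"]
      \<mu>.square_integrable_const[of 0] weak_DW_square_integrable[OF H] w z by blast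
qed

lemma const_in_ker:
  assumes zero: "AE x in \<nu>. \<kappa> x = 0"
  shows "(\<lambda>x. c) \<in> ker_L W V A \<kappa>"
proof -
  have "(LINT x|\<mu>. A x * weak_DW W V (\<lambda>x. c) x * G x) = 0" for G
    by (rule integral_eq_zero_AE) (use weak_DW_const[of c] in \<open>eventually_elim, simp\<close>)
  then show ?thesis
    by (simp add: ker_L_def const_H_space B_form_def zero_potential_energy[OF zero])
qed

lemma ker_L_iff_weak_solution: "w \<in> ker_L W V A \<kappa> \<longleftrightarrow> weak_solution W V A \<kappa> (\<lambda>x. 0) w"
  by (simp add: ker_L_def weak_solution_def L2_inner_def)

text \<open>
  Both terms of the form are nonnegative, so both vanish: the first gives \<open>G = 0\<close>, hence \<open>h\<close> is constant, and
  the second then gives \<open>\<kappa> d = 0\<close>.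
\<close>

lemma form_self_zero:
  assumes h: "is_weak_DW W V h G" "square_integrable \<nu> h" and zero: "form G h G h = 0"
  obtains d where "AE x in \<nu>. h x = d" "AE x in \<nu>. \<kappa> x * d = 0"
proof -
  note G = is_weak_DW_square_integrable[OF h(1)]
  have "A0 * (LINT x|\<mu>. (G x)\<^sup>2) \<le> 0" using gradient_le_form[OF G, of h] zero by simp
  then have "(LINT x|\<mu>. (G x)\<^sup>2) \<le> 0" using A0_pos by (simp add: mult_le_0_iff)
  then have "(LINT x|\<mu>. (G x)\<^sup>2) = 0" by (simp add: order_antisym)
  then have G0: "AE x in \<mu>. G x = 0"
    using integral_nonneg_eq_0_iff_AE[OF square_integrable_square[OF G]] by simp
  have P0: "(LINT y:{0<..x}|\<mu>. G y) = 0" for x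
    unfolding set_lebesgue_integral_def
    by (rule integral_eq_zero_AE) (use G0 in \<open>eventually_elim, simp\<close>)
  obtain d where "AE x in \<nu>. h x = d + (LINT y:{0<..x}|\<mu>. G y)"
    using h(1) by (auto simp: is_weak_DW_def)
  then have d: "AE x in \<nu>. h x = d" by (simp add: P0)
  have "(LINT x|\<nu>. (\<kappa> x)\<^sup>2 * h x * h x) = 0"
    using zero A_energy_nonneg[of G] \<kappa>_energy_nonneg[of h] by (simp add: form_def)
  moreover have "AE x in \<nu>. 0 \<le> (\<kappa> x)\<^sup>2 * h x * h x" by (simp add: mult.assoc)
  ultimately have "AE x in \<nu>. (\<kappa> x)\<^sup>2 * h x * h x = 0"
    using integral_nonneg_eq_0_iff_AE[OF form_integrable(2)[OF h(2) h(2)]] by simp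
  with d have "AE x in \<nu>. \<kappa> x * d = 0" by eventually_elim auto
  with d show ?thesis by (rule that)
qed

lemma is_weak_DW_diff:
  assumes "is_weak_DW W V u F" "is_weak_DW W V v G"
  shows "is_weak_DW W V (\<lambda>x. u x - v x) (\<lambda>x. F x - G x)"
proof -
  note sq = is_weak_DW_square_integrable[OF assms(1)] is_weak_DW_square_integrable[OF assms(2)]
  obtain c d where "AE x in \<nu>. u x = c + primitive F x" "AE x in \<nu>. v x = d + primitive G x"
    using assms unfolding is_weak_DW_def primitive_def by blast
  then have "AE x in \<nu>. u x - v x = (c - d) + primitive (\<lambda>y. F y - G y) x"
    using AE_space by eventually_elim (simp add: primitive_diff[OF sq] space_\<nu>)
  moreover have "(\<lambda>x. F x - G x) \<in> torus_L2_0 \<mu>"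
    using assms square_integrable_diff[OF sq] sq[THEN \<mu>.square_integrable_integrable]
    by (simp add: is_weak_DW_def torus_L2_0_def torus_L2_def one_periodic_def square_integrable_def)
  ultimately show ?thesis by (auto simp: is_weak_DW_def primitive_def)
qed

text \<open>
  Testing both equations with \<open>u\<close> and with \<open>v\<close> shows that the form of the difference vanishes. The difference
  of the two chosen derivatives serves as the derivative of \<open>u - v\<close>.
\<close>

lemma weak_solutions_differ_by_constant:
  assumes u: "weak_solution W V A \<kappa> f u" and v: "weak_solution W V A \<kappa> f v"
  obtains d where "AE x in \<nu>. u x - v x = d" "AE x in \<nu>. \<kappa> x * d = 0"
proof -
  have H: "u \<in> H_space W V" "v \<in> H_space W V" using u v by (auto simp: weak_solution_def)
  define F G where "F = weak_DW W V u" and "G = weak_DW W V v"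
  note sq = weak_DW_square_integrable[OF H(1), folded F_def] weak_DW_square_integrable[OF H(2), folded G_def]
    H[THEN H_space_square_integrable]
  have wd: "is_weak_DW W V (\<lambda>x. u x - v x) (\<lambda>x. F x - G x)"
    unfolding F_def G_def by (intro is_weak_DW_diff H_space_is_weak_DW H)
  have test: "form F u (weak_DW W V w) w = form G v (weak_DW W V w) w" if "w \<in> H_space W V" for w
    using u v that by (simp add: weak_solution_def B_form_eq_form F_def G_def)
  let ?D = "\<lambda>x. F x - G x" and ?d = "\<lambda>x. u x - v x"
  have D_sq: "square_integrable \<mu> ?D" and d_sq: "square_integrable \<nu> ?d"
    by (intro square_integrable_diff sq)+
  have "form ?D ?d F u = 0" "form ?D ?d G v = 0"
    using test[OF H(1)] test[OF H(2)] sq by (simp_all add: form_diff F_def G_def)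
  moreover have "form ?D ?d ?D ?d = form F u ?D ?d - form G v ?D ?d"
    using sq D_sq d_sq by (intro form_diff)
  ultimately have "form ?D ?d ?D ?d = 0" using form_sym[of ?D ?d F u] form_sym[of ?D ?d G v] by linarith
  from form_self_zero[OF wd d_sq this] show ?thesis using that .
qed

lemma zero_weak_solution: "weak_solution W V A \<kappa> (\<lambda>x. 0) (\<lambda>x. 0)"
proof -
  have "(LINT x|\<mu>. A x * weak_DW W V (\<lambda>x. 0) x * G x) = 0" for G
    by (rule integral_eq_zero_AE) (use weak_DW_const[of 0] in \<open>eventually_elim, simp\<close>)
  then show ?thesis by (simp add: weak_solution_def const_H_space B_form_def L2_inner_def)
qed

lemma not_AE_\<nu>_False: "\<not> (AE x in \<nu>. False)"
  using \<nu>_space_pos by (auto simp: AE_iff_measurable[OF _ refl] measure_def)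

lemma nontrivial_kernel_iff_zero_potential:
  "(\<exists>u. weak_solution W V A \<kappa> (\<lambda>x. 0) u \<and> \<not> (AE x in \<nu>. u x = 0)) \<longleftrightarrow> (AE x in \<nu>. \<kappa> x = 0)"
proof
  assume "\<exists>u. weak_solution W V A \<kappa> (\<lambda>x. 0) u \<and> \<not> (AE x in \<nu>. u x = 0)"
  then obtain u where u: "weak_solution W V A \<kappa> (\<lambda>x. 0) u" "\<not> (AE x in \<nu>. u x = 0)" by blast
  obtain d where d: "AE x in \<nu>. u x - 0 = d" "AE x in \<nu>. \<kappa> x * d = 0"
    using weak_solutions_differ_by_constant[OF u(1) zero_weak_solution] by blast
  then have "d \<noteq> 0" using u(2) by auto
  then show "AE x in \<nu>. \<kappa> x = 0" using d(2) by simp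
next
  assume zero: "AE x in \<nu>. \<kappa> x = 0"
  have "weak_solution W V A \<kappa> (\<lambda>x. 0) (\<lambda>x. 1)"
    using const_in_ker[OF zero] by (simp add: ker_L_iff_weak_solution)
  moreover have "\<not> (AE x in \<nu>. (1::real) = 0)" using not_AE_\<nu>_False by simp
  ultimately show "\<exists>u. weak_solution W V A \<kappa> (\<lambda>x. 0) u \<and> \<not> (AE x in \<nu>. u x = 0)" by blast
qed

lemma ker_L_AE_const:
  assumes "w \<in> ker_L W V A \<kappa>"
  obtains d where "AE x in \<nu>. w x = d"
  using weak_solutions_differ_by_constant[OF assms[unfolded ker_L_iff_weak_solution] zero_weak_solution]
  by auto

lemma finite_dim_ker:
  assumes zero: "AE x in \<nu>. \<kappa> x = 0"
  shows "finite_dim_ae \<nu> (ker_L W V A \<kappa>)"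
  unfolding finite_dim_ae_def
proof (intro exI[of _ "{\<lambda>x. 1}"] conjI ballI)
  fix w assume "w \<in> ker_L W V A \<kappa>"
  then obtain d where "AE x in \<nu>. w x = d" by (rule ker_L_AE_const)
  then show "\<exists>a. AE x in \<nu>. w x = (\<Sum>b\<in>{\<lambda>x. 1}. a b * b x)"
    by (intro exI[of _ "\<lambda>_. d"]) simp
qed (use const_in_ker[OF zero] in auto)

lemma solvable_iff_orthogonal_ker:
  assumes zero: "AE x in \<nu>. \<kappa> x = 0" and f: "f \<in> torus_L2 \<nu>"
  shows "(\<exists>u. weak_solution W V A \<kappa> f u) \<longleftrightarrow> (\<forall>v\<in>ker_L W V A \<kappa>. (LINT x|\<nu>. v x * f x) = 0)"
proof
  assume "\<exists>u. weak_solution W V A \<kappa> f u"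
  then obtain u where u: "u \<in> H_space W V" "\<And>v. v \<in> H_space W V \<Longrightarrow> B_form W V A \<kappa> u v = L2_inner \<nu> f v"
    by (auto simp: weak_solution_def)
  show "\<forall>v\<in>ker_L W V A \<kappa>. (LINT x|\<nu>. v x * f x) = 0"
  proof
    fix v assume v: "v \<in> ker_L W V A \<kappa>"
    then have "v \<in> H_space W V" "B_form W V A \<kappa> v u = 0" using u(1) by (auto simp: ker_L_def)
    then have "L2_inner \<nu> f v = 0"
      using u(2)[of v] by (simp add: B_form_eq_form form_sym[of "weak_DW W V u"])
    then show "(LINT x|\<nu>. v x * f x) = 0" by (simp add: L2_inner_def mult.commute)
  qed
next
  assume "\<forall>v\<in>ker_L W V A \<kappa>. (LINT x|\<nu>. v x * f x) = 0"
  from this[rule_format, OF const_in_ker[OF zero, of 1]] have "(LINT x|\<nu>. 1 * f x) = 0" .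
  then show "\<exists>u. weak_solution W V A \<kappa> f u"
    using weak_solution_exists_of_zero_potential[OF zero f] by simp
qed

lemma unique_solvability_iff_nontrivial_potential:
  "(\<forall>f\<in>torus_L2 \<nu>. \<exists>u. weak_solution W V A \<kappa> f u \<and>
      (\<forall>u'. weak_solution W V A \<kappa> f u' \<longrightarrow> (AE x in \<nu>. u' x = u x)))
    \<longleftrightarrow> \<not> (AE x in \<nu>. \<kappa> x = 0)" (is "?U \<longleftrightarrow> _")
proof
  assume U: ?U
  show "\<not> (AE x in \<nu>. \<kappa> x = 0)"
  proof
    assume zero: "AE x in \<nu>. \<kappa> x = 0"
    have one: "weak_solution W V A \<kappa> (\<lambda>x. 0) (\<lambda>x. 1)"
      using const_in_ker[OF zero] by (simp add: ker_L_iff_weak_solution)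
    have "(\<lambda>x. 0) \<in> torus_L2 \<nu>" by (rule frakD_torus_L2[OF frakD_const])
    then obtain u where "AE x in \<nu>. (1::real) = u x" "AE x in \<nu>. 0 = u x"
      using U one zero_weak_solution by blast
    then have "AE x in \<nu>. False" by eventually_elim simp
    then show False using not_AE_\<nu>_False by blast
  qed
next
  assume ne: "\<not> (AE x in \<nu>. \<kappa> x = 0)"
  show ?U
  proof
    fix f assume f: "f \<in> torus_L2 \<nu>"
    obtain u where u: "weak_solution W V A \<kappa> f u"
      using weak_solution_exists_of_nontrivial_potential[OF ne f] by blast
    have "AE x in \<nu>. u' x = u x" if u': "weak_solution W V A \<kappa> f u'" for u'
    proof -
      obtain d where d: "AE x in \<nu>. u' x - u x = d" "AE x in \<nu>. \<kappa> x * d = 0"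
        using weak_solutions_differ_by_constant[OF u' u] by blast
      then have "d = 0" using ne by auto
      then show ?thesis using d(1) by simp
    qed
    then show "\<exists>u. weak_solution W V A \<kappa> f u \<and>
        (\<forall>u'. weak_solution W V A \<kappa> f u' \<longrightarrow> (AE x in \<nu>. u' x = u x))" using u by blast
  qed
qed

end

theorem proposition13:
  fixes W V A \<kappa> :: "real \<Rightarrow> real" and A0 K :: real
  assumes "strict_mono W" "cadlag W" "\<And>x. W (x + 1) - W x = W 1 - W 0" "isCont W 0" "W 0 = 0"
    and "strict_mono V" "caglad V" "\<And>x. V (x + 1) - V x = V 1 - V 0" "isCont V 0" "V 0 = 0"
    and "one_periodic A" "A \<in> borel_measurable borel" "0 < A0" "\<And>x. A0 \<le> A x \<and> A x \<le> K"
    and "one_periodic \<kappa>" "\<kappa> \<in> borel_measurable borel" "bounded (range \<kappa>)"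
  defines "unique_solvability \<equiv> \<forall>f\<in>torus_L2 (dV V). \<exists>u. weak_solution W V A \<kappa> f u \<and>
      (\<forall>u'. weak_solution W V A \<kappa> f u' \<longrightarrow> (AE x in dV V. u' x = u x))"
    and "nontrivial_kernel \<equiv> \<exists>u. weak_solution W V A \<kappa> (\<lambda>x. 0) u \<and> \<not> (AE x in dV V. u x = 0)"
  shows "(unique_solvability \<or> nontrivial_kernel) \<and> \<not> (unique_solvability \<and> nontrivial_kernel)
    \<and> (nontrivial_kernel \<longrightarrow>
         finite_dim_ae (dV V) (ker_L W V A \<kappa>)
         \<and> (\<forall>f\<in>torus_L2 (dV V).
              (\<exists>u. weak_solution W V A \<kappa> f u) \<longleftrightarrow>
              (\<forall>v\<in>ker_L W V A \<kappa>. (LINT x|dV V. v x * f x) = 0)))"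
proof -
  interpret torus_operator W V A \<kappa> A0 K
    using assms(1-17) by unfold_locales auto
  have U: "unique_solvability \<longleftrightarrow> \<not> (AE x in dV V. \<kappa> x = 0)"
    unfolding unique_solvability_def by (rule unique_solvability_iff_nontrivial_potential)
  have N: "nontrivial_kernel \<longleftrightarrow> (AE x in dV V. \<kappa> x = 0)"
    unfolding nontrivial_kernel_def by (rule nontrivial_kernel_iff_zero_potential)
  show ?thesis
    unfolding U N using finite_dim_ker solvable_iff_orthogonal_ker by blast
qed

end
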